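(* Let $X$ be a Fréchet space and let $\Gamma:[0,1]\to ck(X)$ be Bochner measurable. Then $\Gamma$ is Pettis integrable in $ck(X)$ if and only if for each equicontinuous set $K\subseteq X^*$ the family $\{\sigma(x^*,\Gamma(\cdot)):x^*\in K\}$ is uniformly integrable on $[0,1]$.
   Context: $X$ is a Fréchet space with topology generated by an increasing sufficient sequence of seminorms $(p_i)$ and metric $d(x,y)=\sum_i2^{-i}\frac{p_i(x-y)}{1+p_i(x-y)}$; $X^*$ its dual. $ck(X)$: nonempty compact convex subsets; $cb(X)$: nonempty closed bounded convex subsets; $H$ the Hausdorff metric induced by $d$. $\sigma(x^*,C)=\sup_{x\in C}\langle x^*,x\rangle$. Lebesgue measure $\mu$ on $[0,1]$. Bochner measurable: there are simple multifunctions $\Gamma_n=\sum_j\chi_{A_j}C_j$ ($A_j$ pairwise disjoint measurable, $C_j\in cb(X)$) with $H(\Gamma_n(t),\Gamma(t))\to0$ a.e. Pettis integrable in $ck(X)$: $\sigma(x^*,\Gamma(\cdot))$ is Lebesgue integrable for each $x^*\in X^*$, and for every measurable $E$ there is $x_E\in ck(X)$ with $\sigma(x^*,x_E)=\int_E\sigma(x^*,\Gamma(t))dt$ for all $x^*\in X^*$. *)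

theory Defs
  imports "HOL-Analysis.Analysis"
begin

definition seminorm :: "('a::real_vector \<Rightarrow> real) \<Rightarrow> bool" where
  "seminorm q \<longleftrightarrow> (\<forall>x. 0 \<le> q x) \<and> (\<forall>c x. q (c *\<^sub>R x) = \<bar>c\<bar> * q x)
     \<and> (\<forall>x y. q (x + y) \<le> q x + q y)"

definition frechet_dist :: "(nat \<Rightarrow> 'a::real_vector \<Rightarrow> real) \<Rightarrow> 'a \<Rightarrow> 'a \<Rightarrow> real" where
  "frechet_dist p x y = (\<Sum>i. (1/2) ^ Suc i * (p i (x - y) / (1 + p i (x - y))))"

definition frechet_topology :: "(nat \<Rightarrow> 'a::real_vector \<Rightarrow> real) \<Rightarrow> 'a topology" where
  "frechet_topology p = Metric_space.mtopology UNIV (frechet_dist p)"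

definition frechet_space :: "(nat \<Rightarrow> 'a::real_vector \<Rightarrow> real) \<Rightarrow> bool" where
  "frechet_space p \<longleftrightarrow> (\<forall>i. seminorm (p i)) \<and> (\<forall>i x. p i x \<le> p (Suc i) x)
     \<and> (\<forall>x. (\<forall>i. p i x = 0) \<longrightarrow> x = 0)
     \<and> Metric_space.mcomplete UNIV (frechet_dist p)"

definition dual_space :: "(nat \<Rightarrow> 'a::real_vector \<Rightarrow> real) \<Rightarrow> ('a \<Rightarrow> real) set" where
  "dual_space p = {f. linear f \<and> continuous_map (frechet_topology p) euclideanreal f}"

definition equicontinuous_dual :: "(nat \<Rightarrow> 'a::real_vector \<Rightarrow> real) \<Rightarrow> ('a \<Rightarrow> real) set \<Rightarrow> bool" where
  "equicontinuous_dual p K \<longleftrightarrow> K \<subseteq> dual_space p \<and>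
     (\<forall>x0. \<forall>e>0. \<exists>\<delta>>0. \<forall>x. frechet_dist p x0 x < \<delta> \<longrightarrow> (\<forall>f\<in>K. \<bar>f x - f x0\<bar> < e))"

text \<open>ck(X): nonempty compact convex sets; cb(X): nonempty closed bounded convex sets
 (bounded in the topological vector space sense: every seminorm is bounded on the set).\<close>
definition ck :: "(nat \<Rightarrow> 'a::real_vector \<Rightarrow> real) \<Rightarrow> 'a set set" where
  "ck p = {C. C \<noteq> {} \<and> compactin (frechet_topology p) C \<and> convex C}"

definition cb :: "(nat \<Rightarrow> 'a::real_vector \<Rightarrow> real) \<Rightarrow> 'a set set" where
  "cb p = {C. C \<noteq> {} \<and> closedin (frechet_topology p) C \<and> (\<forall>i. \<exists>M. \<forall>x\<in>C. p i x \<le> M) \<and> convex C}"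

definition hausdorff_dist :: "(nat \<Rightarrow> 'a::real_vector \<Rightarrow> real) \<Rightarrow> 'a set \<Rightarrow> 'a set \<Rightarrow> real" where
  "hausdorff_dist p A B =
     max (SUP a\<in>A. INF b\<in>B. frechet_dist p a b) (SUP b\<in>B. INF a\<in>A. frechet_dist p a b)"

definition support_fun :: "('a \<Rightarrow> real) \<Rightarrow> 'a set \<Rightarrow> real" where
  "support_fun f C = (SUP x\<in>C. f x)"

definition simple_multifunction :: "(nat \<Rightarrow> 'a::real_vector \<Rightarrow> real) \<Rightarrow> (real \<Rightarrow> 'a set) \<Rightarrow> bool" where
  "simple_multifunction p G \<longleftrightarrow> (\<exists>(m::nat) (A::nat \<Rightarrow> real set) (C::nat \<Rightarrow> 'a set).
     (\<forall>j<m. A j \<in> sets lebesgue \<and> A j \<subseteq> {0..1} \<and> C j \<in> cb p)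
     \<and> (\<forall>j<m. \<forall>k<m. j \<noteq> k \<longrightarrow> A j \<inter> A k = {})
     \<and> (\<Union>j<m. A j) = {0..1}
     \<and> (\<forall>j<m. \<forall>t\<in>A j. G t = C j))"

definition bochner_measurable_mf :: "(nat \<Rightarrow> 'a::real_vector \<Rightarrow> real) \<Rightarrow> (real \<Rightarrow> 'a set) \<Rightarrow> bool" where
  "bochner_measurable_mf p \<Gamma> \<longleftrightarrow> (\<exists>G. (\<forall>n. simple_multifunction p (G n)) \<and>
     (AE t in lebesgue_on {0..1}. (\<lambda>n. hausdorff_dist p (G n t) (\<Gamma> t)) \<longlonglongrightarrow> 0))"

definition pettis_integrable_ck :: "(nat \<Rightarrow> 'a::real_vector \<Rightarrow> real) \<Rightarrow> (real \<Rightarrow> 'a set) \<Rightarrow> bool" where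
  "pettis_integrable_ck p \<Gamma> \<longleftrightarrow>
     (\<forall>f\<in>dual_space p. integrable (lebesgue_on {0..1}) (\<lambda>t. support_fun f (\<Gamma> t)))
     \<and> (\<forall>E. E \<in> sets lebesgue \<and> E \<subseteq> {0..1} \<longrightarrow>
          (\<exists>xE\<in>ck p. \<forall>f\<in>dual_space p.
             support_fun f xE = integral\<^sup>L (lebesgue_on E) (\<lambda>t. support_fun f (\<Gamma> t))))"

definition uniformly_integrable_01 :: "(real \<Rightarrow> real) set \<Rightarrow> bool" where
  "uniformly_integrable_01 F \<longleftrightarrow>
     (\<forall>g\<in>F. integrable (lebesgue_on {0..1}) g)
     \<and> (\<exists>M. \<forall>g\<in>F. integral\<^sup>L (lebesgue_on {0..1}) (\<lambda>t. \<bar>g t\<bar>) \<le> M)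
     \<and> (\<forall>e>0. \<exists>\<delta>>0. \<forall>E. E \<in> sets lebesgue \<and> E \<subseteq> {0..1} \<and> measure lebesgue E < \<delta> \<longrightarrow>
          (\<forall>g\<in>F. integral\<^sup>L (lebesgue_on E) (\<lambda>t. \<bar>g t\<bar>) < e))"

end

theory Submission
  imports Defs "HOL-Complex_Analysis.Great_Picard"
begin

text \<open>
  Bochner measurability cuts \<open>[0,1]\<close>, up to a set of small measure, into finitely many measurable
  pieces on each of which \<open>\<Gamma>\<close> oscillates little in a given seminorm.

  If the families of support functions are uniformly integrable, replacing \<open>\<Gamma>\<close> on a piece by one of
  its values gives weighted Minkowski sums whose support functions converge to \<open>\<integral>\<^sub>E \<sigma>(f, \<Gamma>)\<close> uniformly
  over the polar of each seminorm. By Hahn-Banach these sums form a Cauchy sequence for the Hausdorff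
  distances, and completeness of \<open>ck\<close> yields the Pettis integral.

  Conversely, the same partitions show that \<open>\<Gamma>\<close> is essentially separably valued, so a sequence in an
  equicontinuous set has a subsequence converging pointwise on the closed span of the range; by
  separation this span contains all Pettis integrals. Hence the support functions converge almost
  everywhere and their integrals converge over every measurable set, which by a Vitali-Hahn-Saks
  argument forces convergence in \<open>L\<^sup>1\<close>. Sequential precompactness in \<open>L\<^sup>1\<close> gives uniform integrability.
\<close>

section \<open>Hahn-Banach for sublinear functionals\<close>

text \<open>The values of the approximating simple multifunctions are only closed and bounded, so
  Minkowski sums of them need not be precompact. Each value is therefore traded for a sampled
  \<open>\<Gamma> (c j)\<close>, which is compact and still close. Everything is measured in one
  seminorm at a time: by separation, \<open>p i\<close>-closeness of convex sets amounts to
  closeness of support functions uniformly on the polar of \<open>p i\<close>, and every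
  equicontinuous set lies in a multiple of such a polar. The seminorms are combined only at the end:
  the approximant of index \<open>n\<close> is accurate to about 2^-n in \<open>p n\<close>.

  The converse needs separability because in a nonseparable space a sequence in a polar may have no
  pointwise convergent subsequence. Separability with respect to the single seminorm
  \<open>p i\<close> suffices, since the members of its polar are Lipschitz for \<open>p i\<close>.
  The Pettis integral yields convergence of integrals one set at a time; the gain in uniformity over
  all sets comes from a gliding hump.\<close>

definition sublinear :: "('a::real_vector \<Rightarrow> real) \<Rightarrow> bool" where
  "sublinear q \<longleftrightarrow> (\<forall>c x. 0 \<le> c \<longrightarrow> q (c *\<^sub>R x) = c * q x) \<and> (\<forall>x y. q (x + y) \<le> q x + q y)"

lemma sublinear_scale: "sublinear q \<Longrightarrow> 0 \<le> c \<Longrightarrow> q (c *\<^sub>R x) = c * q x"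
  and sublinear_add: "sublinear q \<Longrightarrow> q (x + y) \<le> q x + q y"
  by (auto simp: sublinear_def)

lemma sublinear_zero: "sublinear q \<Longrightarrow> q 0 = 0"
  using sublinear_scale[of q 0 0] by simp

lemma sublinear_neg: "sublinear q \<Longrightarrow> - q (- x) \<le> q x"
  using sublinear_add[of q x "- x"] sublinear_zero[of q] by simp

lemma sublinearI:
  assumes "q 0 = 0" and le: "\<And>c x. 0 < c \<Longrightarrow> q (c *\<^sub>R x) \<le> c * q x"
    and "\<And>x y. q (x + y) \<le> q x + q y"
  shows "sublinear q"
proof -
  have "q (c *\<^sub>R x) = c * q x" if "0 \<le> c" for c x
  proof (cases "c = 0")
    case False
    with that have c: "0 < c" by simp
    have "q x \<le> inverse c * q (c *\<^sub>R x)"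
      using le[of "inverse c" "c *\<^sub>R x"] c by simp
    hence "c * q x \<le> q (c *\<^sub>R x)"
      using c by (simp add: field_simps)
    with le[OF c, of x] show ?thesis by simp
  qed (simp add: assms)
  thus ?thesis using assms by (auto simp: sublinear_def)
qed

text \<open>Three infima below have this shape: over a ray parameter, over a chain, and over a ray
  parameter together with a point of a convex set. \<open>L\<close> keeps the infimum finite, and
  \<open>sc\<close> and \<open>ad\<close> ask only that some index does at least as well.\<close>

lemma sublinear_INF:
  assumes ne: "I \<noteq> {}" and lb: "\<And>i x. i \<in> I \<Longrightarrow> L x \<le> h i x"
    and sc: "\<And>i c x. i \<in> I \<Longrightarrow> 0 < c \<Longrightarrow> \<exists>j\<in>I. h j (c *\<^sub>R x) \<le> c * h i x"
    and ad: "\<And>i j x y. i \<in> I \<Longrightarrow> j \<in> I \<Longrightarrow> \<exists>k\<in>I. h k (x + y) \<le> h i x + h j y"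
    and z0: "\<And>i. i \<in> I \<Longrightarrow> 0 \<le> h i 0" and z1: "\<exists>i\<in>I. h i 0 \<le> 0"
  shows "sublinear (\<lambda>x. INF i\<in>I. h i x)"
proof -
  have bdd: "bdd_below ((\<lambda>i. h i x) ` I)" for x
    using lb by (auto intro!: bdd_belowI2)
  have low: "(INF i\<in>I. h i x) \<le> v" if "\<exists>j\<in>I. h j x \<le> v" for x v
    using that cINF_lower[OF bdd] by (blast intro: order_trans)
  show ?thesis
  proof (rule sublinearI)
    show "(INF i\<in>I. h i 0) = 0"
      using low[OF z1] cINF_greatest[OF ne z0] by (simp add: antisym)
  next
    fix c :: real and x assume c: "0 < c"
    have "inverse c * (INF i\<in>I. h i (c *\<^sub>R x)) \<le> (INF i\<in>I. h i x)"
    proof (rule cINF_greatest[OF ne])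
      fix i assume "i \<in> I"
      hence "(INF i\<in>I. h i (c *\<^sub>R x)) \<le> c * h i x" by (intro low sc c)
      thus "inverse c * (INF i\<in>I. h i (c *\<^sub>R x)) \<le> h i x"
        using c by (simp add: field_simps)
    qed
    thus "(INF i\<in>I. h i (c *\<^sub>R x)) \<le> c * (INF i\<in>I. h i x)"
      using c by (simp add: field_simps)
  next
    fix x y
    have "(INF i\<in>I. h i (x + y)) - (INF i\<in>I. h i y) \<le> h i x" if "i \<in> I" for i
    proof -
      have "(INF i\<in>I. h i (x + y)) - h i x \<le> (INF i\<in>I. h i y)"
      proof (rule cINF_greatest[OF ne])
        fix j assume "j \<in> I"
        with low[OF ad[OF that this, of x y]]
        show "(INF i\<in>I. h i (x + y)) - h i x \<le> h j y" by simp
      qed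
      thus ?thesis by simp
    qed
    hence "(INF i\<in>I. h i (x + y)) - (INF i\<in>I. h i y) \<le> (INF i\<in>I. h i x)"
      by (intro cINF_greatest[OF ne])
    thus "(INF i\<in>I. h i (x + y)) \<le> (INF i\<in>I. h i x) + (INF i\<in>I. h i y)" by simp
  qed
qed

text \<open>Lowering \<open>m\<close> along a direction \<open>y\<close> to \<open>z \<mapsto> inf\<^bsub>t\<ge>0\<^esub> m(z + ty) - t m(y)\<close> keeps it
  sublinear, so minimality forces \<open>m\<close> to be additive; no extension of functionals is needed.\<close>

lemma minimal_sublinear_linear:
  assumes m: "sublinear m" and minimal: "\<And>m'. sublinear m' \<Longrightarrow> (\<And>x. m' x \<le> m x) \<Longrightarrow> m' = m"
  shows "linear m"
proof -
  have super: "m x + m y \<le> m (x + y)" for x y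
  proof -
    define h where "h t z = m (z + t *\<^sub>R y) - t * m y" for t z
    define m' where "m' z = (INF t\<in>{0..}. h t z)" for z
    have lb: "- m (- z) \<le> h t z" if "t \<in> {0..}" for t z
    proof -
      have "t * m y = m (t *\<^sub>R y)" using that sublinear_scale[OF m] by simp
      thus ?thesis
        using sublinear_add[OF m, of "z + t *\<^sub>R y" "- z"] by (simp add: h_def)
    qed
    have "sublinear (\<lambda>z. INF t\<in>{0..}. h t z)"
    proof (rule sublinear_INF[OF _ lb])
      fix t c :: real and z assume "t \<in> {0..}" "0 < c"
      hence "h (c * t) (c *\<^sub>R z) \<le> c * h t z"
        using sublinear_scale[OF m, of c "z + t *\<^sub>R y"] by (simp add: h_def algebra_simps)
      thus "\<exists>j\<in>{0..}. h j (c *\<^sub>R z) \<le> c * h t z"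
        using \<open>t \<in> {0..}\<close> \<open>0 < c\<close> by (intro bexI[of _ "c * t"]) auto
    next
      fix s t :: real and z w assume st: "s \<in> {0..}" "t \<in> {0..}"
      have "h (s + t) (z + w) \<le> h s z + h t w"
        using sublinear_add[OF m, of "z + s *\<^sub>R y" "w + t *\<^sub>R y"] by (simp add: h_def algebra_simps)
      thus "\<exists>k\<in>{0..}. h k (z + w) \<le> h s z + h t w"
        using st by (intro bexI[of _ "s + t"]) auto
    next
      fix t :: real assume "t \<in> {0..}"
      thus "0 \<le> h t 0" using sublinear_scale[OF m] by (simp add: h_def)
    next
      show "\<exists>t\<in>{0..}. h t 0 \<le> 0"
        using sublinear_zero[OF m] by (intro bexI[of _ 0]) (auto simp: h_def)
    qed auto
    moreover have bdd: "bdd_below ((\<lambda>t. h t z) ` {0..})" for z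
      using lb by (auto intro!: bdd_belowI2)
    have "m' z \<le> m z" for z
      unfolding m'_def using cINF_lower[OF bdd, of 0 z] by (simp add: h_def)
    ultimately have "m' = m"
      by (intro minimal) (auto simp: m'_def[abs_def])
    \<comment> \<open>The parameter 1 in the infimum; with \<open>m' = m\<close> this is
      superadditivity.\<close>
    moreover have "m' x \<le> m (x + y) - m y"
      unfolding m'_def using cINF_lower[OF bdd, of 1 x] by (simp add: h_def)
    ultimately show ?thesis by simp
  qed
  have add: "m (x + y) = m x + m y" for x y
    using super[of x y] sublinear_add[OF m, of x y] by simp
  have neg: "m (- x) = - m x" for x
    using add[of x "- x"] sublinear_zero[OF m] by simp
  show ?thesis
  proof (rule linearI)
    fix c x show "m (c *\<^sub>R x) = c *\<^sub>R m x"
    proof (cases "0 \<le> c")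
      case False
      hence "m ((- c) *\<^sub>R x) = - c * m x" by (intro sublinear_scale[OF m]) auto
      thus ?thesis using neg[of "c *\<^sub>R x"] by simp
    qed (simp add: sublinear_scale[OF m])
  qed (rule add)
qed

text \<open>Zorn's lemma is applied with the order reversed, so that a maximal element is a minimal
  sublinear functional below \<open>q\<close>. Chains are bounded by their pointwise infimum, which
  is finite because every member lies above \<open>- q (- x)\<close>.\<close>

theorem hahn_banach_sublinear:
  assumes q: "sublinear q"
  obtains f where "linear f" "\<And>x. f x \<le> q x"
proof -
  define A where "A = {m. sublinear m \<and> (\<forall>x. m x \<le> q x)}"
  define P where "P = (\<lambda>m n :: 'a \<Rightarrow> real. \<forall>x. n x \<le> m x)"
  have "\<exists>m\<in>A. \<forall>a\<in>A. P m a \<longrightarrow> a = m"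
  proof (rule predicate_Zorn)
    show "partial_order_on A (relation_of P A)"
      by (rule partial_order_on_relation_ofI) (auto simp: P_def fun_eq_iff intro: order_trans antisym)
  next
    fix C assume C: "C \<in> Chains (relation_of P A)"
    hence CA: "C \<subseteq> A" by (auto simp: Chains_def relation_of_def)
    have tot: "P m n \<or> P n m" if "m \<in> C" "n \<in> C" for m n
      using C that by (auto simp: Chains_def relation_of_def)
    show "\<exists>u\<in>A. \<forall>a\<in>C. P a u"
    proof (cases "C = {}")
      case True thus ?thesis using q by (auto simp: A_def)
    next
      case False
      have lb: "- q (- x) \<le> m x" if "m \<in> C" for m x
      proof -
        have "sublinear m" "m (- x) \<le> q (- x)" using that CA by (auto simp: A_def)
        thus ?thesis using sublinear_neg[of m x] by simp
      qed
      have "sublinear (\<lambda>x. INF m\<in>C. m x)"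
      proof (rule sublinear_INF[OF False lb])
        fix m c x assume "m \<in> C" "0 < (c::real)"
        thus "\<exists>j\<in>C. j (c *\<^sub>R x) \<le> c * m x"
          using CA sublinear_scale[of m c x] by (intro bexI[of _ m]) (auto simp: A_def)
      next
        fix m n x y assume mn: "m \<in> C" "n \<in> C"
        hence sub: "sublinear m" "sublinear n" using CA by (auto simp: A_def)
        \<comment> \<open>Of two members of a chain, the smaller one serves both summands.\<close>
        from tot[OF mn] show "\<exists>k\<in>C. k (x + y) \<le> m x + n y"
        proof
          assume "P m n"
          thus ?thesis using mn sublinear_add[OF sub(2), of x y]
            by (intro bexI[of _ n]) (auto simp: P_def intro: order_trans add_right_mono)
        next
          assume "P n m"
          thus ?thesis using mn sublinear_add[OF sub(1), of x y]
            by (intro bexI[of _ m]) (auto simp: P_def intro: order_trans add_left_mono)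
        qed
      next
        show "0 \<le> m 0" if "m \<in> C" for m
          using that CA sublinear_zero[of m] by (auto simp: A_def)
        show "\<exists>m\<in>C. m 0 \<le> 0"
          using False CA sublinear_zero by (fastforce simp: A_def)
      qed
      moreover have low: "(INF m\<in>C. m x) \<le> m x" if "m \<in> C" for m x
        using lb that by (intro cINF_lower) (auto intro!: bdd_belowI2)
      moreover obtain m where "m \<in> C" using False by auto
      ultimately have "(\<lambda>x. INF m\<in>C. m x) \<in> A"
        using CA by (auto simp: A_def intro!: order_trans[OF low])
      thus ?thesis by (rule rev_bexI) (simp add: P_def low)
    qed
  qed
  then obtain m where m: "m \<in> A" and min: "\<And>a. a \<in> A \<Longrightarrow> P m a \<Longrightarrow> a = m" by blast
  have "linear m"
  proof (rule minimal_sublinear_linear)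
    show "sublinear m" using m by (simp add: A_def)
  next
    fix m' assume "sublinear m'" "\<And>x. m' x \<le> m x"
    thus "m' = m" using m by (intro min) (auto simp: A_def P_def intro: order_trans)
  qed
  thus ?thesis using m that by (auto simp: A_def)
qed

text \<open>Apply Hahn-Banach to \<open>x \<mapsto> inf q(x + t(b - a)) - t r\<close> over \<open>t \<ge> 0\<close> and \<open>a \<in> A\<close>, which is
  sublinear since \<open>A\<close> is convex, below \<open>q\<close>, and at most \<open>-r\<close> at \<open>a - b\<close>.\<close>

theorem seminorm_separation:
  assumes q: "seminorm q" and A: "convex A" "A \<noteq> {}" and r: "\<And>a. a \<in> A \<Longrightarrow> r \<le> q (b - a)"
  obtains f where "linear f" "\<And>x. \<bar>f x\<bar> \<le> q x" "\<And>a. a \<in> A \<Longrightarrow> f a + r \<le> f b"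
proof -
  have qs: "q (c *\<^sub>R x) = \<bar>c\<bar> * q x" and qa: "q (x + y) \<le> q x + q y" for c x y
    using q by (auto simp: seminorm_def)
  have qm: "q (- x) = q x" for x using qs[of "-1" x] by simp
  define I where "I = {0::real..} \<times> A"
  define h where "h i x = q (x + fst i *\<^sub>R (b - snd i)) - fst i * r" for i x
  \<comment> \<open>The distance hypothesis enters through this inequality: it keeps the infimum
    finite and its value at 0 nonnegative.\<close>
  have ray: "t * r \<le> q (t *\<^sub>R (b - a))" if "0 \<le> t" "a \<in> A" for t a
    using qs[of t "b - a"] r[OF that(2)] that(1) by (simp add: mult_left_mono)
  have lb: "- q x \<le> h i x" if "i \<in> I" for i x
    using ray[of "fst i" "snd i"] that qm[of x] qa[of "x + fst i *\<^sub>R (b - snd i)" "- x"]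
    by (auto simp: h_def I_def)
  have sub: "sublinear (\<lambda>x. INF i\<in>I. h i x)"
  proof (rule sublinear_INF[OF _ lb])
    show "I \<noteq> {}" using A by (auto simp: I_def)
  next
    fix i c x assume i: "i \<in> I" and c: "0 < (c::real)"
    have "h (c * fst i, snd i) (c *\<^sub>R x) \<le> c * h i x"
      using qs[of c "x + fst i *\<^sub>R (b - snd i)"] c by (simp add: h_def algebra_simps)
    thus "\<exists>j\<in>I. h j (c *\<^sub>R x) \<le> c * h i x"
      using i c by (intro bexI[of _ "(c * fst i, snd i)"]) (auto simp: I_def)
  next
    fix i j x y assume i: "i \<in> I" and j: "j \<in> I"
    obtain s a t a' where ij: "i = (s, a)" "j = (t, a')" by (metis surj_pair)
    with i j have nn: "0 \<le> s" "0 \<le> t" "a \<in> A" "a' \<in> A" by (auto simp: I_def)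
    have *: "h i x + h j y \<ge> q ((x + y) + (s *\<^sub>R (b - a) + t *\<^sub>R (b - a'))) - (s + t) * r"
      using qa[of "x + s *\<^sub>R (b - a)" "y + t *\<^sub>R (b - a')"] by (simp add: ij h_def algebra_simps)
    show "\<exists>k\<in>I. h k (x + y) \<le> h i x + h j y"
    proof (cases "s + t = 0")
      case True
      with nn have "s = 0" "t = 0" by auto
      with * show ?thesis using nn by (intro bexI[of _ "(0, a)"]) (auto simp: h_def I_def)
    next
      case False
      with nn have st: "0 < s + t" by simp
      \<comment> \<open>The weights are chosen so that the ray of length \<open>s + t\<close>
        through \<open>a''\<close> is the sum of the two given rays. Dividing by
        \<open>s + t\<close> is why the case of sum zero is separate.\<close>
      define a'' where "a'' = (s / (s + t)) *\<^sub>R a + (t / (s + t)) *\<^sub>R a'"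
      have "a'' \<in> A" unfolding a''_def
        using st nn by (intro convexD[OF A(1)]) (simp_all add: add_divide_distrib[symmetric])
      moreover have "(s + t) *\<^sub>R a'' = s *\<^sub>R a + t *\<^sub>R a'"
        using st by (simp add: a''_def scaleR_add_right)
      hence "(s + t) *\<^sub>R (b - a'') = s *\<^sub>R (b - a) + t *\<^sub>R (b - a')"
        by (simp add: algebra_simps)
      ultimately show ?thesis using * st
        by (intro bexI[of _ "(s + t, a'')"]) (auto simp: h_def I_def)
    qed
  next
    fix i assume "i \<in> I" thus "0 \<le> h i 0"
      using ray[of "fst i" "snd i"] by (auto simp: h_def I_def)
  next
    obtain a where "a \<in> A" using A by auto
    thus "\<exists>i\<in>I. h i 0 \<le> 0"
      using qs[of 0 0] by (intro bexI[of _ "(0, a)"]) (auto simp: h_def I_def)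
  qed
  obtain f where f: "linear f" and le: "\<And>x. f x \<le> (INF i\<in>I. h i x)"
    using hahn_banach_sublinear[OF sub] by blast
  have fh: "f x \<le> h i x" if "i \<in> I" for i x
    using le[of x] cINF_lower[OF bdd_belowI2, of I "- q x" "\<lambda>i. h i x" i] lb that by force
  have fq: "f x \<le> q x" for x
  proof -
    obtain a where "a \<in> A" using A by auto
    thus ?thesis using fh[of "(0, a)" x] by (simp add: I_def h_def)
  qed
  show ?thesis
  proof
    show "linear f" by (rule f)
    show "\<bar>f x\<bar> \<le> q x" for x
      using fq[of x] fq[of "- x"] qm[of x] linear_neg[OF f, of x] by simp
    show "f a + r \<le> f b" if "a \<in> A" for a
      using fh[of "(1, a)" "a - b"] that qs[of 0 0] linear_diff[OF f, of a b]
      by (simp add: I_def h_def)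
  qed
qed

section \<open>Measure theory\<close>

text \<open>The norm is the sum of the masses on the sets where \<open>h\<close> is positive and
  negative, so one of the two carries at least half.\<close>

lemma integral_abs_half:
  fixes h :: "'a \<Rightarrow> real"
  assumes "integrable M h"
  obtains P where "P \<in> sets M" "(\<integral>x. \<bar>h x\<bar> \<partial>M) \<le> 2 * \<bar>\<integral>x. indicator P x * h x \<partial>M\<bar>"
proof -
  have [measurable]: "h \<in> borel_measurable M" using assms by auto
  define P where "P = {x\<in>space M. 0 < h x}"
  define Q where "Q = {x\<in>space M. h x < 0}"
  have "P \<in> sets M" "Q \<in> sets M"
    using borel_measurable_less[of "\<lambda>_. 0" M h] borel_measurable_less[of h M "\<lambda>_. 0"]
    by (simp_all add: P_def Q_def)
  have int: "integrable M (\<lambda>x. indicator A x * h x)" if "A \<in> sets M" for A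
    using integrable_mult_indicator[OF that assms] by simp
  have "(\<integral>x. \<bar>h x\<bar> \<partial>M) = (\<integral>x. indicator P x * h x - indicator Q x * h x \<partial>M)"
    by (intro Bochner_Integration.integral_cong) (auto simp: P_def Q_def indicator_def)
  also have "\<dots> = (\<integral>x. indicator P x * h x \<partial>M) - (\<integral>x. indicator Q x * h x \<partial>M)"
    by (intro Bochner_Integration.integral_diff int) fact+
  finally have "(\<integral>x. \<bar>h x\<bar> \<partial>M) \<le> 2 * \<bar>\<integral>x. indicator P x * h x \<partial>M\<bar> \<or>
      (\<integral>x. \<bar>h x\<bar> \<partial>M) \<le> 2 * \<bar>\<integral>x. indicator Q x * h x \<partial>M\<bar>" by linarith
  thus ?thesis using that \<open>P \<in> sets M\<close> \<open>Q \<in> sets M\<close> by blast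
qed

text \<open>Let \<open>B N\<close> be the set where \<open>\<bar>h n\<bar> \<le> \<eta>\<close> for all \<open>n \<ge> N\<close>. If the \<open>L\<^sup>1\<close> norms stay large, some \<open>h (n k)\<close> has
  most of its mass in the shell \<open>B (a (k + 1)) - B (a k)\<close>; on the union of the halves of these
  disjoint shells where \<open>h (n k)\<close> has one sign, the integrals do not tend to zero.\<close>

lemma (in finite_measure) setwise_null_imp_L1_null:
  fixes h :: "nat \<Rightarrow> 'a \<Rightarrow> real"
  assumes int: "\<And>n. integrable M (h n)" and ae: "AE x in M. (\<lambda>n. h n x) \<longlonglongrightarrow> 0"
    and set: "\<And>E. E \<in> sets M \<Longrightarrow> (\<lambda>n. \<integral>x. indicator E x * h n x \<partial>M) \<longlonglongrightarrow> 0"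
  shows "(\<lambda>n. \<integral>x. \<bar>h n x\<bar> \<partial>M) \<longlonglongrightarrow> 0"
proof (rule ccontr)
  assume "\<not> ?thesis"
  then obtain e where e: "0 < e" and large: "\<And>N. \<exists>n\<ge>N. e \<le> (\<integral>x. \<bar>h n x\<bar> \<partial>M)"
    by (auto simp: LIMSEQ_iff not_less)
  have [measurable]: "h n \<in> borel_measurable M" for n using int[of n] by auto
  have inti: "integrable M (\<lambda>x. indicator A x * h n x)" if "A \<in> sets M" for A n
    using integrable_mult_indicator[OF that int] by simp
  have intai: "integrable M (\<lambda>x. indicator A x * \<bar>h n x\<bar>)" if "A \<in> sets M" for A n
    using integrable_mult_indicator[OF that integrable_abs[OF int]] by simp
  \<comment> \<open>Values of size at most \<open>\<eta>\<close> contribute at most e/8 in total;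
    the added 1 avoids a division by zero.\<close>
  obtain \<eta> where \<eta>: "0 < \<eta>" and \<eta>e: "\<eta> * measure M (space M) \<le> e / 8"
  proof
    have pos: "0 < 1 + measure M (space M)" by (simp add: add_pos_nonneg)
    show "0 < e / 8 / (1 + measure M (space M))" using e pos by simp
    show "e / 8 / (1 + measure M (space M)) * measure M (space M) \<le> e / 8"
      using e pos by (simp add: divide_le_eq algebra_simps)
  qed
  define B where "B N = {x\<in>space M. \<forall>n\<ge>N. \<bar>h n x\<bar> \<le> \<eta>}" for N
  have [measurable]: "B N \<in> sets M" for N unfolding B_def by measurable
  have Bmono: "B N \<subseteq> B N'" if "N \<le> N'" for N N' using that by (auto simp: B_def)
  \<comment> \<open>By almost everywhere convergence the complements of \<open>B N\<close> decrease
    to a null set, so the fixed integrable \<open>h n\<close> has little mass there for large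
    \<open>N\<close>.\<close>
  have tail: "\<exists>N'>n. (\<integral>x. indicator (space M - B N') x * \<bar>h n x\<bar> \<partial>M) < e / 8" for n
  proof -
    have "(\<lambda>N. \<integral>x. indicator (space M - B N) x * \<bar>h n x\<bar> \<partial>M) \<longlonglongrightarrow> (\<integral>x. 0 \<partial>M)"
    proof (rule integral_dominated_convergence[where w = "\<lambda>x. \<bar>h n x\<bar>"])
      show "AE x in M. (\<lambda>N. indicator (space M - B N) x * \<bar>h n x\<bar>) \<longlonglongrightarrow> 0"
        using ae
      proof eventually_elim
        case (elim x)
        then obtain N0 where N0: "\<forall>n\<ge>N0. \<bar>h n x\<bar> \<le> \<eta>"
          using \<eta> unfolding LIMSEQ_iff real_norm_def diff_zero by (meson less_imp_le)
        have "indicator (space M - B N) x * \<bar>h n x\<bar> = 0" if "N \<ge> N0" for N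
          using that N0 by (auto simp: B_def indicator_def)
        hence "eventually (\<lambda>N. indicator (space M - B N) x * \<bar>h n x\<bar> = 0) sequentially"
          by (auto simp: eventually_sequentially)
        thus ?case by (rule tendsto_eventually)
      qed
    qed (auto simp: indicator_def intro!: integrable_abs int)
    hence "eventually (\<lambda>N. (\<integral>x. indicator (space M - B N) x * \<bar>h n x\<bar> \<partial>M) < e / 8) sequentially"
      using e by (intro order_tendstoD(2)) auto
    hence "eventually (\<lambda>N. N > n \<and> (\<integral>x. indicator (space M - B N) x * \<bar>h n x\<bar> \<partial>M) < e / 8) sequentially"
      using eventually_gt_at_top[of n] by eventually_elim auto
    thus ?thesis by (auto simp: eventually_sequentially)
  qed
  obtain \<nu> where \<nu>: "\<And>N. N \<le> \<nu> N" "\<And>N. e \<le> (\<integral>x. \<bar>h (\<nu> N) x\<bar> \<partial>M)"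
    using large by metis
  obtain \<tau> where \<tau>: "\<And>n. n < \<tau> n"
      "\<And>n. (\<integral>x. indicator (space M - B (\<tau> n)) x * \<bar>h n x\<bar> \<partial>M) < e / 8"
    using tail by metis
  \<comment> \<open>From a threshold \<open>a k\<close>, \<open>\<nu>\<close> gives an index at or
    past it with large norm, and \<open>\<tau>\<close> the next threshold, chosen so that this
    function has little mass outside the corresponding \<open>B\<close>.\<close>
  define a where "a k = ((\<tau> \<circ> \<nu>) ^^ k) 0" for k
  have aS: "a (Suc k) = \<tau> (\<nu> (a k))" for k by (simp add: a_def)
  have "a k < a (Suc k)" for k
    using \<nu>(1)[of "a k"] \<tau>(1)[of "\<nu> (a k)"] by (simp add: aS)
  hence mono: "strict_mono a" by (simp add: strict_mono_Suc_iff)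
  define n where "n k = \<nu> (a k)" for k
  have na: "a k \<le> n k" for k by (simp add: n_def \<nu>)
  have nk: "k \<le> n k" for k using na[of k] seq_suble[OF mono, of k] by simp
  obtain P where P: "\<And>k. P k \<in> sets M"
      "\<And>k. (\<integral>x. \<bar>h k x\<bar> \<partial>M) \<le> 2 * \<bar>\<integral>x. indicator (P k) x * h k x \<partial>M\<bar>"
  proof -
    have "\<exists>A. A \<in> sets M \<and> (\<integral>x. \<bar>h k x\<bar> \<partial>M) \<le> 2 * \<bar>\<integral>x. indicator A x * h k x \<partial>M\<bar>" for k
      by (rule integral_abs_half[OF int[of k]]) blast
    thus ?thesis using that by metis
  qed
  note [measurable] = P(1)
  define Q where "Q k = P (n k) \<inter> (B (a (Suc k)) - B (a k))" for k
  define E where "E = (\<Union>k. Q k)"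
  have [measurable]: "E \<in> sets M" unfolding E_def Q_def by measurable
  \<comment> \<open>\<open>B\<close> is increasing, so the shells are disjoint and no other
    \<open>Q j\<close> meets the shell of index \<open>k\<close>.\<close>
  have E_shell: "x \<in> E \<longleftrightarrow> x \<in> P (n k)" if x: "x \<in> B (a (Suc k))" "x \<notin> B (a k)" for x k
  proof -
    have "j = k" if "x \<in> B (a (Suc j)) - B (a j)" for j
    proof (rule ccontr)
      assume "j \<noteq> k"
      then consider "Suc j \<le> k" | "Suc k \<le> j" by linarith
      thus False
      proof cases
        case 1
        hence "a (Suc j) \<le> a k" using strict_mono_less_eq[OF mono] by blast
        thus False using x that Bmono by blast
      next
        case 2
        hence "a (Suc k) \<le> a j" using strict_mono_less_eq[OF mono] by blast
        thus False using x that Bmono by blast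
      qed
    qed
    note shell = this
    show ?thesis
    proof
      assume "x \<in> E"
      then obtain j where j: "x \<in> Q j" by (auto simp: E_def)
      hence "j = k" by (intro shell) (simp add: Q_def)
      thus "x \<in> P (n k)" using j by (simp add: Q_def)
    next
      assume "x \<in> P (n k)"
      hence "x \<in> Q k" using x by (simp add: Q_def)
      thus "x \<in> E" by (auto simp: E_def)
    qed
  qed
  \<comment> \<open>Replacing \<open>P (n k)\<close> by \<open>E\<close> changes nothing on the
    shell, costs at most \<open>\<eta>\<close> pointwise inside \<open>B (a k)\<close> because
    \<open>a k \<le> n k\<close>, and at most the tail outside \<open>B (a (Suc k))\<close>. The
    half mass e/2 thus loses at most e/8 + e/8.\<close>
  have far: "e / 4 \<le> \<bar>\<integral>x. indicator E x * h (n k) x \<partial>M\<bar>" for k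
  proof -
    let ?D = "\<lambda>x. indicator E x * h (n k) x - indicator (P (n k)) x * h (n k) x"
    let ?R = "\<lambda>x. \<eta> + indicator (space M - B (a (Suc k))) x * \<bar>h (n k) x\<bar>"
    have intR: "integrable M ?R" by (intro Bochner_Integration.integrable_add intai) auto
    have DR: "\<bar>?D x\<bar> \<le> ?R x" if x: "x \<in> space M" for x
    proof -
      have *: "\<bar>?D x\<bar> \<le> \<bar>h (n k) x\<bar>" by (auto simp: indicator_def)
      show "\<bar>?D x\<bar> \<le> ?R x"
      proof (cases "x \<in> B (a (Suc k))")
        case False thus ?thesis using * x \<eta> by (auto simp: indicator_def)
      next
        case t: True
        show ?thesis
        proof (cases "x \<in> B (a k)")
          case True
          hence "\<bar>h (n k) x\<bar> \<le> \<eta>" using na[of k] by (auto simp: B_def)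
          thus ?thesis using * t by auto
        next
          case False
          thus ?thesis using E_shell[OF t False] t \<eta> by (auto simp: indicator_def)
        qed
      qed
    qed
    have "integrable M ?D" by (intro Bochner_Integration.integrable_diff inti) auto
    hence "integrable M (\<lambda>x. \<bar>?D x\<bar>)" by (rule integrable_abs)
    hence "(\<integral>x. \<bar>?D x\<bar> \<partial>M) \<le> (\<integral>x. ?R x \<partial>M)" by (rule integral_mono[OF _ intR DR])
    hence "\<bar>\<integral>x. ?D x \<partial>M\<bar> \<le> (\<integral>x. ?R x \<partial>M)"
      by (rule order_trans[OF integral_abs_bound])
    also have "\<dots> = \<eta> * measure M (space M) + (\<integral>x. indicator (space M - B (a (Suc k))) x * \<bar>h (n k) x\<bar> \<partial>M)"
      by (subst Bochner_Integration.integral_add) (auto intro!: intai)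
    also have "\<dots> \<le> e / 8 + e / 8"
      using \<tau>(2)[of "n k"] \<eta>e by (intro add_mono) (auto simp: n_def aS)
    finally have "\<bar>(\<integral>x. indicator E x * h (n k) x \<partial>M) - (\<integral>x. indicator (P (n k)) x * h (n k) x \<partial>M)\<bar> \<le> e / 4"
      by (subst (asm) Bochner_Integration.integral_diff) (auto intro!: inti)
    moreover have "e \<le> 2 * \<bar>\<integral>x. indicator (P (n k)) x * h (n k) x \<partial>M\<bar>"
      using P(2)[of "n k"] \<nu>(2)[of "a k"] by (simp add: n_def)
    ultimately show ?thesis by linarith
  qed
  obtain N where "\<And>m. m \<ge> N \<Longrightarrow> \<bar>\<integral>x. indicator E x * h m x \<partial>M\<bar> < e / 4"
  proof -
    have "\<exists>N. \<forall>m\<ge>N. norm ((\<integral>x. indicator E x * h m x \<partial>M) - 0) < e / 4"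
      using e by (intro LIMSEQ_D[OF set]) auto
    thus ?thesis using that by auto
  qed
  with far[of N] nk[of N] show False by fastforce
qed

text \<open>A failure gives index pairs beyond every \<open>N\<close> at distance at least
  \<open>e\<close>. Along such pairs the differences of any Cauchy sequence tend to 0, both
  pointwise and for the integrals over each set, so the null sequence version applies to
  them.\<close>

lemma (in finite_measure) setwise_Cauchy_imp_L1_Cauchy:
  fixes g :: "nat \<Rightarrow> 'a \<Rightarrow> real"
  assumes int: "\<And>n. integrable M (g n)" and ae: "AE x in M. Cauchy (\<lambda>n. g n x)"
    and set: "\<And>E. E \<in> sets M \<Longrightarrow> Cauchy (\<lambda>n. \<integral>x. indicator E x * g n x \<partial>M)"
    and e: "0 < e"
  shows "\<exists>N. \<forall>m\<ge>N. \<forall>n\<ge>N. (\<integral>x. \<bar>g m x - g n x\<bar> \<partial>M) < e"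
proof (rule ccontr)
  assume "\<not> ?thesis"
  then obtain m n where mn: "\<And>N. N \<le> m N" "\<And>N. N \<le> n N"
      "\<And>N. e \<le> (\<integral>x. \<bar>g (m N) x - g (n N) x\<bar> \<partial>M)"
    by (simp add: not_less) metis
  have diff: "(\<lambda>N. u (m N) - u (n N)) \<longlonglongrightarrow> 0" if "Cauchy u" for u :: "nat \<Rightarrow> real"
  proof -
    have m: "filterlim m sequentially sequentially" and n: "filterlim n sequentially sequentially"
      using mn(1,2) by (auto intro: filterlim_at_top_mono[OF filterlim_ident])
    obtain l where l: "u \<longlonglongrightarrow> l"
      using \<open>Cauchy u\<close> by (metis Cauchy_convergent_iff convergent_def)
    have "(\<lambda>N. u (m N) - u (n N)) \<longlonglongrightarrow> l - l"
      by (rule tendsto_diff[OF filterlim_compose[OF l m] filterlim_compose[OF l n]])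
    thus ?thesis by simp
  qed
  have inti: "integrable M (\<lambda>x. indicator A x * g n x)" if "A \<in> sets M" for A n
    using integrable_mult_indicator[OF that int] by simp
  have "(\<lambda>N. \<integral>x. \<bar>g (m N) x - g (n N) x\<bar> \<partial>M) \<longlonglongrightarrow> 0"
  proof (rule setwise_null_imp_L1_null)
    show "AE x in M. (\<lambda>N. g (m N) x - g (n N) x) \<longlonglongrightarrow> 0"
      using ae by eventually_elim (rule diff)
    show "(\<lambda>N. \<integral>x. indicator E x * (g (m N) x - g (n N) x) \<partial>M) \<longlonglongrightarrow> 0" if "E \<in> sets M" for E
      using diff[OF set[OF that]] inti[OF that] by (simp add: right_diff_distrib)
  qed (auto intro: int)
  hence "e \<le> 0" using mn(3) by (intro LIMSEQ_le_const) auto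
  with e show False by simp
qed

text \<open>Truncation: the excess of \<open>\<bar>g\<bar>\<close> over a high level
  \<open>n\<close> has integral below e/2 on the whole space, and the part below the level
  contributes at most \<open>n\<close> times the measure of \<open>E\<close>.\<close>

lemma (in finite_measure) integral_absolutely_continuous:
  fixes g :: "'a \<Rightarrow> real"
  assumes g: "integrable M g" and e: "0 < e"
  shows "\<exists>\<delta>>0. \<forall>E\<in>sets M. measure M E < \<delta> \<longrightarrow> (\<integral>x. indicator E x * \<bar>g x\<bar> \<partial>M) < e"
proof -
  have [measurable]: "g \<in> borel_measurable M" using g by auto
  have "(\<lambda>n. \<integral>x. max (\<bar>g x\<bar> - real n) 0 \<partial>M) \<longlonglongrightarrow> (\<integral>x. 0 \<partial>M)"
  proof (rule integral_dominated_convergence[where w = "\<lambda>x. \<bar>g x\<bar>"])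
    show "AE x in M. (\<lambda>n. max (\<bar>g x\<bar> - real n) 0) \<longlonglongrightarrow> 0"
    proof (rule AE_I2)
      fix x
      obtain N where N: "\<bar>g x\<bar> < real N" using reals_Archimedean2 by blast
      have "max (\<bar>g x\<bar> - real n) 0 = 0" if "N \<le> n" for n
        using N that by auto
      thus "(\<lambda>n. max (\<bar>g x\<bar> - real n) 0) \<longlonglongrightarrow> 0"
        by (intro tendsto_eventually) (auto simp: eventually_sequentially)
    qed
  qed (use g in \<open>auto intro: integrable_abs\<close>)
  hence "eventually (\<lambda>n. (\<integral>x. max (\<bar>g x\<bar> - real n) 0 \<partial>M) < e / 2) sequentially"
    using e by (intro order_tendstoD(2)) auto
  then obtain n where n: "(\<integral>x. max (\<bar>g x\<bar> - real n) 0 \<partial>M) < e / 2" by (auto simp: eventually_sequentially)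
  have "(\<integral>x. indicator E x * \<bar>g x\<bar> \<partial>M) < e" if E: "E \<in> sets M" and small: "measure M E < e / (2 * (real n + 1))" for E
  proof -
    have i1: "integrable M (\<lambda>x. indicator E x * real n)"
      using E by (intro integrable_mult_left integrable_real_indicator) (auto simp: less_top[symmetric])
    have i2: "integrable M (\<lambda>x. max (\<bar>g x\<bar> - real n) 0)"
      by (rule Bochner_Integration.integrable_bound[OF g]) auto
    have i3: "integrable M (\<lambda>x. indicator E x * \<bar>g x\<bar>)"
      using integrable_mult_indicator[OF E integrable_abs[OF g]] by simp
    have "(\<integral>x. indicator E x * \<bar>g x\<bar> \<partial>M) \<le> (\<integral>x. indicator E x * real n + max (\<bar>g x\<bar> - real n) 0 \<partial>M)"
      by (rule integral_mono[OF i3 Bochner_Integration.integrable_add[OF i1 i2]]) (auto simp: indicator_def)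
    also have "\<dots> = measure M E * real n + (\<integral>x. max (\<bar>g x\<bar> - real n) 0 \<partial>M)"
      using E by (subst Bochner_Integration.integral_add[OF i1 i2]) simp
    also have "measure M E * real n \<le> e / (2 * (real n + 1)) * real n"
      using small by (intro mult_right_mono) auto
    also have "\<dots> \<le> e / 2" using e by (simp add: field_simps)
    finally show ?thesis using n by simp
  qed
  thus ?thesis using e by (intro exI[of _ "e / (2 * (real n + 1))"]) auto
qed

section \<open>Passing between Lebesgue measure restricted to a subset and indicators on the unit
  interval\<close>

lemma integral_lebesgue_on_subset:
  fixes g :: "real \<Rightarrow> real"
  assumes "E \<in> sets lebesgue" "E \<subseteq> S" "S \<in> sets lebesgue"
  shows "integral\<^sup>L (lebesgue_on E) g = (\<integral>t. indicator E t * g t \<partial>lebesgue_on S)"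
proof -
  have "integral\<^sup>L (lebesgue_on E) g = (\<integral>t. indicator E t *\<^sub>R g t \<partial>lebesgue)"
    using assms by (intro integral_restrict_space) auto
  also have "\<dots> = (\<integral>t. indicator S t *\<^sub>R (indicator E t * g t) \<partial>lebesgue)"
    using assms by (intro Bochner_Integration.integral_cong) (auto simp: indicator_def)
  also have "\<dots> = (\<integral>t. indicator E t * g t \<partial>lebesgue_on S)"
    using assms by (intro integral_restrict_space[symmetric]) auto
  finally show ?thesis .
qed

lemma measure_lebesgue_on_subset:
  assumes "E \<in> sets lebesgue" "E \<subseteq> S" "S \<in> sets lebesgue"
  shows "measure (lebesgue_on S) E = measure lebesgue E"
  using assms by (intro measure_restrict_space) auto

lemma finite_measure_unit: "finite_measure (lebesgue_on {0..1::real})"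
  by (rule finite_measureI) (simp add: emeasure_restrict_space)

lemma measure_unit: "measure (lebesgue_on {0..1::real}) (space (lebesgue_on {0..1})) = 1"
  by (simp add: measure_restrict_space)

lemma sets_lebesgue_on_unit: "E \<in> sets lebesgue \<Longrightarrow> E \<subseteq> {0..1} \<Longrightarrow> E \<in> sets (lebesgue_on {0..1::real})"
  by (simp add: sets_restrict_space_iff)

section \<open>Seminorms and compactness in Frechet spaces\<close>

lemma ratio_mono: "0 \<le> s \<Longrightarrow> s \<le> t \<Longrightarrow> s / (1 + s) \<le> t / (1 + t)" for s t :: real
  by (simp add: field_simps)

lemma ratio_subadd: "0 \<le> a \<Longrightarrow> 0 \<le> b \<Longrightarrow> (a + b) / (1 + (a + b)) \<le> a / (1 + a) + b / (1 + b)" for a b :: real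
proof -
  assume ab: "0 \<le> a" "0 \<le> b"
  have "a / (1 + (a + b)) \<le> a / (1 + a)" "b / (1 + (a + b)) \<le> b / (1 + b)"
    using ab by (auto intro!: divide_left_mono)
  thus ?thesis by (simp add: add_divide_distrib)
qed

locale frechet =
  fixes p :: "nat \<Rightarrow> 'a::real_vector \<Rightarrow> real"
  assumes frechet: "frechet_space p"
begin

lemma seminorm: "seminorm (p i)"
  using frechet by (auto simp: frechet_space_def)

lemma p_nonneg [simp]: "0 \<le> p i x"
  and p_scale: "p i (c *\<^sub>R x) = \<bar>c\<bar> * p i x"
  and p_add: "p i (x + y) \<le> p i x + p i y"
  using seminorm[of i] by (auto simp: seminorm_def)

lemma p_zero [simp]: "p i 0 = 0"
  using p_scale[of i 0 0] by simp

lemma p_minus_commute: "p i (x - y) = p i (y - x)"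
  using p_scale[of i "-1" "x - y"] by simp

lemma p_triangle: "p i (x - z) \<le> p i (x - y) + p i (y - z)"
  using p_add[of i "x - y" "y - z"] by simp

lemma p_mono: "i \<le> j \<Longrightarrow> p i x \<le> p j x"
  using frechet lift_Suc_mono_le[of "\<lambda>i. p i x"] by (auto simp: frechet_space_def)

lemma p_separates: "(\<And>i. p i x = 0) \<Longrightarrow> x = 0"
  using frechet by (auto simp: frechet_space_def)

section \<open>The metric compared with the seminorms\<close>

definition dterm :: "'a \<Rightarrow> nat \<Rightarrow> real" where
  "dterm x i = (1/2) ^ Suc i * (p i x / (1 + p i x))"

lemma dterm_nonneg [simp]: "0 \<le> dterm x i"
  by (simp add: dterm_def)

lemma dterm_le: "dterm x i \<le> (1/2) ^ Suc i"
proof -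
  have "p i x / (1 + p i x) \<le> 1" using p_nonneg[of i x] by (simp add: field_simps add_pos_nonneg)
  from mult_left_mono[OF this, of "(1/2) ^ Suc i"] show ?thesis by (simp add: dterm_def)
qed

lemma summable_half: "summable (\<lambda>i. (1/2::real) ^ Suc i)"
  using power_half_series by (rule sums_summable)

lemma summable_dterm: "summable (dterm x)"
  by (rule summable_comparison_test'[OF summable_half, of 0]) (use dterm_le[of x] in auto)

lemma frechet_dist_eq: "frechet_dist p x y = suminf (dterm (x - y))"
  unfolding frechet_dist_def dterm_def[abs_def] ..

lemma dterm_le_dist: "dterm (x - y) i \<le> frechet_dist p x y"
  unfolding frechet_dist_eq
  using sum_le_suminf[OF summable_dterm[of "x - y"], of "{i}"] by simp

lemma Metric_space_frechet: "Metric_space UNIV (frechet_dist p)"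
proof
  fix x y z
  show "0 \<le> frechet_dist p x y"
    unfolding frechet_dist_eq by (intro suminf_nonneg summable_dterm) simp
  show "frechet_dist p x y = frechet_dist p y x"
    by (simp add: frechet_dist_def p_minus_commute[of _ x y])
  show "frechet_dist p x y = 0 \<longleftrightarrow> x = y"
  proof
    assume "frechet_dist p x y = 0"
    hence "dterm (x - y) i = 0" for i
      using dterm_le_dist[of x y i] dterm_nonneg[of "x - y" i] by (metis order_antisym)
    hence "p i (x - y) = 0" for i
      using p_nonneg[of i "x - y"] by (simp add: dterm_def add_nonneg_eq_0_iff)
    thus "x = y" using p_separates[of "x - y"] by simp
  qed (simp add: frechet_dist_def)
  have "dterm (x - z) i \<le> dterm (x - y) i + dterm (y - z) i" for i
  proof -
    have "p i (x - z) / (1 + p i (x - z)) \<le> p i (x - y) / (1 + p i (x - y)) + p i (y - z) / (1 + p i (y - z))"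
      by (rule order_trans[OF ratio_mono[OF p_nonneg p_triangle] ratio_subadd]) auto
    from mult_left_mono[OF this, of "(1/2) ^ Suc i"] show ?thesis by (simp add: dterm_def distrib_left)
  qed
  hence "suminf (dterm (x - z)) \<le> (\<Sum>i. dterm (x - y) i + dterm (y - z) i)"
    by (intro suminf_le summable_add summable_dterm)
  thus "frechet_dist p x z \<le> frechet_dist p x y + frechet_dist p y z"
    unfolding frechet_dist_eq using suminf_add[OF summable_dterm summable_dterm] by simp
qed

sublocale ms: Metric_space UNIV "frechet_dist p"
  by (rule Metric_space_frechet)

lemma frechet_topology_eq: "frechet_topology p = ms.mtopology"
  by (simp add: frechet_topology_def)

lemma mcomplete: "ms.mcomplete"
  using frechet by (simp add: frechet_space_def)

lemma frechet_dist_le_1: "frechet_dist p x y \<le> 1"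
proof -
  have "suminf (dterm (x - y)) \<le> (\<Sum>i. (1/2::real) ^ Suc i)"
    by (intro suminf_le summable_dterm summable_half dterm_le)
  also have "\<dots> = 1" using power_half_series by (rule sums_unique[symmetric])
  finally show ?thesis by (simp add: frechet_dist_eq)
qed

lemma dist_small_imp_p_small:
  assumes e: "0 < e"
  obtains \<delta> where "0 < \<delta>" "\<And>x y. frechet_dist p x y < \<delta> \<Longrightarrow> p i (x - y) < e"
proof
  \<comment> \<open>This is the summand of index \<open>i\<close> of the metric when the seminorm
    equals \<open>e\<close>; as t/(1 + t) increases, a smaller summand forces a smaller
    seminorm.\<close>
  show "0 < (1/2) ^ Suc i * (e / (1 + e))" using e by simp
  fix x y assume "frechet_dist p x y < (1/2) ^ Suc i * (e / (1 + e))"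
  with dterm_le_dist[of x y i] have "dterm (x - y) i < (1/2) ^ Suc i * (e / (1 + e))" by simp
  hence "p i (x - y) / (1 + p i (x - y)) < e / (1 + e)"
    unfolding dterm_def by (rule mult_left_less_imp_less) simp
  thus "p i (x - y) < e" using ratio_mono[of e "p i (x - y)"] e by (meson less_imp_le not_le)
qed

text \<open>The geometric tail after \<open>n\<close> is below e/2 whatever the points are, and the
  first \<open>n\<close> summands are controlled by the single seminorm \<open>p n\<close> because
  the sequence increases.\<close>

lemma p_small_imp_dist_small:
  assumes e: "0 < e"
  obtains i \<delta> where "0 < \<delta>" "\<And>x y. p i (x - y) < \<delta> \<Longrightarrow> frechet_dist p x y < e"
proof -
  obtain n where n: "(1/2::real) ^ n < e / 2"
    using real_arch_pow_inv[of "e / 2" "1/2"] e by auto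
  have "frechet_dist p x y < e" if "p n (x - y) < e / 2" for x y
  proof -
    have "dterm (x - y) i \<le> (1/2) ^ Suc i * (e / 2)" if "i < n" for i
    proof -
      have "p i (x - y) / (1 + p i (x - y)) \<le> p i (x - y)"
        using p_nonneg[of i "x - y"] by (simp add: divide_le_eq add_pos_nonneg algebra_simps)
      also have "\<dots> \<le> e / 2"
        using p_mono[of i n "x - y"] that \<open>p n (x - y) < e / 2\<close> by simp
      finally show ?thesis unfolding dterm_def by (intro mult_left_mono) auto
    qed
    hence "(\<Sum>i<n. dterm (x - y) i) \<le> (\<Sum>i<n. (1/2) ^ Suc i * (e / 2))"
      by (intro sum_mono) auto
    also have "\<dots> = (\<Sum>i<n. (1/2) ^ Suc i) * (e / 2)" by (rule sum_distrib_right[symmetric])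
    also have "\<dots> \<le> 1 * (e / 2)"
      using sum_le_suminf[OF summable_half, of "{..<n}"] sums_unique[OF power_half_series] e
      by (intro mult_right_mono) auto
    finally have head: "(\<Sum>i<n. dterm (x - y) i) \<le> e / 2" by simp
    have s: "(\<lambda>i. (1/2::real) ^ Suc (i + n)) sums (1/2) ^ n"
      using sums_mult[OF power_half_series, of "(1/2) ^ n"] by (simp add: power_add mult_ac)
    have "(\<Sum>i. dterm (x - y) (i + n)) \<le> (\<Sum>i. (1/2::real) ^ Suc (i + n))"
      using summable_ignore_initial_segment[OF summable_dterm, of "x - y" n] s dterm_le[of "x - y"]
      by (intro suminf_le) (auto simp: sums_iff)
    also have "\<dots> < e / 2" using s n by (simp add: sums_iff)
    finally show ?thesis
      using head suminf_split_initial_segment[OF summable_dterm, of "x - y" n]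
      by (simp add: frechet_dist_eq)
  qed
  thus ?thesis using e by (intro that[of "e / 2" n]) auto
qed

text \<open>Total boundedness read one seminorm at a time, with centres in the set itself; the two
  comparisons of metric and seminorms link it to the metric notion.\<close>

definition tot_bdd :: "'a set \<Rightarrow> bool" where
  "tot_bdd S \<longleftrightarrow> (\<forall>i. \<forall>e>0. \<exists>F. finite F \<and> F \<subseteq> S \<and> (\<forall>x\<in>S. \<exists>y\<in>F. p i (x - y) < e))"

lemma tot_bddD:
  assumes "tot_bdd S" "0 < e"
  obtains F where "finite F" "F \<subseteq> S" "\<And>x. x \<in> S \<Longrightarrow> \<exists>y\<in>F. p i (x - y) < e"
  using assms unfolding tot_bdd_def by meson

text \<open>The net may have centres outside \<open>S\<close> and refer to a larger seminorm: a
  centre that is close to some point of \<open>S\<close> is replaced by such a point, at the price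
  of halving \<open>e\<close>.\<close>

lemma tot_bddI:
  assumes "\<And>i e. 0 < e \<Longrightarrow> \<exists>j F. i \<le> j \<and> finite F \<and> (\<forall>x\<in>S. \<exists>y\<in>F. p j (x - y) < e)"
  shows "tot_bdd S"
  unfolding tot_bdd_def
proof (intro allI impI)
  fix i and e :: real assume "0 < e"
  then obtain j F where jF: "i \<le> j" "finite F" "\<And>x. x \<in> S \<Longrightarrow> \<exists>y\<in>F. p j (x - y) < e / 2"
    using assms[of "e / 2" i] by auto
  have F: "\<exists>y\<in>F. p i (x - y) < e / 2" if x: "x \<in> S" for x
  proof -
    obtain y where "y \<in> F" "p j (x - y) < e / 2" using jF(3)[OF x] by auto
    thus ?thesis using p_mono[OF jF(1), of "x - y"] by (intro bexI[of _ y]) simp_all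
  qed
  define c where "c y = (SOME x. x \<in> S \<and> p i (x - y) < e / 2)" for y
  have c: "c y \<in> S \<and> p i (c y - y) < e / 2" if "x \<in> S" "p i (x - y) < e / 2" for x y
    unfolding c_def by (rule someI[of _ x]) (use that in auto)
  let ?F = "c ` {y\<in>F. \<exists>x\<in>S. p i (x - y) < e / 2}"
  have "\<exists>z\<in>?F. p i (x - z) < e" if x: "x \<in> S" for x
  proof -
    obtain y where y: "y \<in> F" "p i (x - y) < e / 2" using F x by auto
    have "p i (x - c y) < e"
      using p_triangle[of i x "c y" y] c[OF x y(2)] y(2) p_minus_commute[of i y "c y"] by simp
    thus ?thesis using x y by auto
  qed
  thus "\<exists>F. finite F \<and> F \<subseteq> S \<and> (\<forall>x\<in>S. \<exists>y\<in>F. p i (x - y) < e)"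
    using jF(2) c by (intro exI[of _ ?F]) auto
qed

lemma ck_tot_bdd:
  assumes "C \<in> ck p" shows "tot_bdd C"
  unfolding tot_bdd_def
proof (intro allI impI)
  fix i and e :: real assume "0 < e"
  then obtain \<delta> where \<delta>: "0 < \<delta>" "\<And>x y. frechet_dist p x y < \<delta> \<Longrightarrow> p i (x - y) < e"
    using dist_small_imp_p_small[of e i] by metis
  have "ms.mtotally_bounded C"
    using assms ms.compactin_imp_mtotally_bounded by (simp add: ck_def frechet_topology_eq)
  then obtain F where F: "finite F" "F \<subseteq> C" "C \<subseteq> (\<Union>x\<in>F. ms.mball x \<delta>)"
    unfolding ms.mtotally_bounded_def using \<delta>(1) by meson
  have "\<exists>y\<in>F. p i (x - y) < e" if x: "x \<in> C" for x
  proof -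
    obtain y where "y \<in> F" "x \<in> ms.mball y \<delta>" using F(3) x by auto
    thus ?thesis using \<delta>(2)[of x y] ms.commute[of x y] by (intro bexI[of _ y]) simp_all
  qed
  thus "\<exists>F. finite F \<and> F \<subseteq> C \<and> (\<forall>x\<in>C. \<exists>y\<in>F. p i (x - y) < e)"
    using F by blast
qed

text \<open>In a complete metric space closed totally bounded sets are compact; both conditions are
  stated through seminorms, the form in which the limit sets below can be checked.\<close>

lemma ckI:
  assumes "S \<noteq> {}" "convex S" "tot_bdd S"
    and closed: "\<And>x. (\<And>i e. 0 < e \<Longrightarrow> \<exists>y\<in>S. p i (x - y) < e) \<Longrightarrow> x \<in> S"
  shows "S \<in> ck p"
proof -
  have "ms.mtotally_bounded S"
    unfolding ms.mtotally_bounded_def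
  proof (intro allI impI)
    fix e :: real assume "0 < e"
    then obtain i \<delta> where i: "0 < \<delta>" "\<And>x y. p i (x - y) < \<delta> \<Longrightarrow> frechet_dist p x y < e"
      using p_small_imp_dist_small by metis
    obtain F where F: "finite F" "F \<subseteq> S" "\<And>x. x \<in> S \<Longrightarrow> \<exists>y\<in>F. p i (x - y) < \<delta>"
      using tot_bddD[OF assms(3) i(1)] by metis
    have "S \<subseteq> (\<Union>x\<in>F. ms.mball x e)"
      using F(3) i(2) by (fastforce simp: ms.in_mball ms.commute)
    thus "\<exists>K. finite K \<and> K \<subseteq> S \<and> S \<subseteq> (\<Union>x\<in>K. ms.mball x e)" using F by auto
  qed
  moreover have "closedin ms.mtopology S"
    unfolding ms.closedin_metric
  proof (intro conjI allI impI)
    fix x assume "x \<in> UNIV - S"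
    then obtain i e where ie: "0 < e" "\<And>y. y \<in> S \<Longrightarrow> e \<le> p i (x - y)"
      using closed[of x] by (force simp: not_less)
    obtain \<delta> where "0 < \<delta>" "\<And>x y. frechet_dist p x y < \<delta> \<Longrightarrow> p i (x - y) < e"
      using dist_small_imp_p_small[OF ie(1)] by metis
    thus "\<exists>r>0. disjnt S (ms.mball x r)"
      using ie(2) by (fastforce simp: disjnt_iff ms.in_mball)
  qed simp
  ultimately have "compactin ms.mtopology S"
    using ms.mtotally_bounded_eq_compact_closure_of[OF mcomplete, of S] by (simp add: closure_of_closedin)
  thus ?thesis using assms by (simp add: ck_def frechet_topology_eq)
qed

text \<open>For positive \<open>c\<close> these functionals form \<open>c\<close> times the polar of
  the unit ball of \<open>p i\<close>. Such sets are equicontinuous, and every equicontinuous set is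
  contained in one of them.\<close>

definition dominated :: "nat \<Rightarrow> real \<Rightarrow> ('a \<Rightarrow> real) \<Rightarrow> bool" where
  "dominated i c f \<longleftrightarrow> linear f \<and> (\<forall>x. \<bar>f x\<bar> \<le> c * p i x)"

lemma dominated_linear: "dominated i c f \<Longrightarrow> linear f"
  and dominated_bound: "dominated i c f \<Longrightarrow> \<bar>f x\<bar> \<le> c * p i x"
  by (auto simp: dominated_def)

lemma dominated_diff: "dominated i c f \<Longrightarrow> \<bar>f x - f y\<bar> \<le> c * p i (x - y)"
  using dominated_bound[of i c f "x - y"] by (simp add: dominated_linear linear_diff)

lemma equicontinuous_dominated:
  assumes c: "0 < c" shows "equicontinuous_dual p {f. dominated i c f}"
proof -
  have eq: "\<exists>\<delta>>0. \<forall>x. frechet_dist p x0 x < \<delta> \<longrightarrow> (\<forall>f\<in>{f. dominated i c f}. \<bar>f x - f x0\<bar> < e)"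
    if e: "0 < e" for x0 e
  proof -
    obtain \<delta> where \<delta>: "0 < \<delta>" "\<And>x y. frechet_dist p x y < \<delta> \<Longrightarrow> p i (x - y) < e / c"
      using dist_small_imp_p_small[of "e / c" i] e c by auto
    have "\<bar>f x - f x0\<bar> < e" if "frechet_dist p x0 x < \<delta>" "dominated i c f" for f x
    proof -
      have "\<bar>f x - f x0\<bar> \<le> c * p i (x0 - x)"
        using dominated_diff[OF that(2), of x x0] p_minus_commute[of i x x0] by simp
      also have "\<dots> < e" using \<delta>(2)[OF that(1)] c by (simp add: field_simps)
      finally show ?thesis .
    qed
    thus ?thesis using \<delta>(1) by blast
  qed
  moreover have "f \<in> dual_space p" if f: "dominated i c f" for f
  proof -
    have "\<exists>\<delta>>0. \<forall>x. x \<in> UNIV \<and> frechet_dist p a x < \<delta> \<longrightarrow> dist (f a) (f x) < e" if "0 < e" for a e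
      using eq[OF that, of a] f by (fastforce simp: dist_real_def abs_minus_commute)
    hence "continuous_map ms.mtopology (Met_TC.mtopology) f"
      by (subst ms.metric_continuous_map[OF Met_TC.Metric_space_axioms]) auto
    thus ?thesis using f by (simp add: dual_space_def frechet_topology_eq dominated_linear)
  qed
  ultimately show ?thesis unfolding equicontinuous_dual_def by blast
qed

lemma dominated_dual: "0 < c \<Longrightarrow> dominated i c f \<Longrightarrow> f \<in> dual_space p"
  using equicontinuous_dominated by (auto simp: equicontinuous_dual_def)

text \<open>By homogeneity a bound on a ball of \<open>p i\<close> becomes a bound by a multiple of
  \<open>p i\<close>. A set \<open>K\<close> of functionals is allowed so that equicontinuous sets
  and single continuous functionals are covered at once.\<close>

lemma dominated_of_bounded_near_zero:
  assumes lin: "\<And>f. f \<in> K \<Longrightarrow> linear f"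
    and \<delta>: "0 < \<delta>" "\<And>f x. f \<in> K \<Longrightarrow> frechet_dist p 0 x < \<delta> \<Longrightarrow> \<bar>f x\<bar> < 1"
  obtains i c where "0 < c" "\<And>f. f \<in> K \<Longrightarrow> dominated i c f"
proof -
  obtain i \<eta> where \<eta>: "0 < \<eta>" "\<And>x y. p i (x - y) < \<eta> \<Longrightarrow> frechet_dist p x y < \<delta>"
    using p_small_imp_dist_small[OF \<delta>(1)] by metis
  have small: "\<bar>f x\<bar> < 1" if "f \<in> K" "p i x < \<eta>" for f x
    using \<delta>(2)[OF that(1)] \<eta>(2)[of 0 x] that(2) p_minus_commute[of i 0 x] by simp
  have "\<bar>f x\<bar> \<le> (1 / \<eta>) * p i x" if f: "f \<in> K" for f x
  proof (rule field_le_epsilon)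
    fix e :: real assume e: "0 < e"
    \<comment> \<open>The summand \<open>e\<close> keeps \<open>s\<close> positive even where
      \<open>p i\<close> vanishes, so \<open>x\<close> can be scaled by 1/s into the ball.\<close>
    define s where "s = p i x / \<eta> + e"
    have s: "0 < s" "p i x < \<eta> * s"
      using e \<eta>(1) p_nonneg[of i x] by (simp_all add: s_def add_nonneg_pos distrib_left)
    have "p i ((1 / s) *\<^sub>R x) < \<eta>" using s by (simp add: p_scale field_simps)
    hence "\<bar>f ((1 / s) *\<^sub>R x)\<bar> < 1" by (rule small[OF f])
    hence "\<bar>f x\<bar> < s" using s(1) linear_scale[OF lin[OF f], of "1 / s" x] by (simp add: abs_mult field_simps)
    thus "\<bar>f x\<bar> \<le> (1 / \<eta>) * p i x + e" by (simp add: s_def)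
  qed
  thus ?thesis using \<eta>(1) lin by (intro that[of "1 / \<eta>" i]) (auto simp: dominated_def)
qed

lemma equicontinuous_imp_dominated:
  assumes "equicontinuous_dual p K"
  obtains i c where "0 < c" "\<And>f. f \<in> K \<Longrightarrow> dominated i c f"
proof -
  have lin: "\<And>f. f \<in> K \<Longrightarrow> linear f"
    using assms by (auto simp: equicontinuous_dual_def dual_space_def)
  obtain \<delta> where "0 < \<delta>" "\<And>x. frechet_dist p 0 x < \<delta> \<Longrightarrow> \<forall>f\<in>K. \<bar>f x - f 0\<bar> < 1"
    using assms unfolding equicontinuous_dual_def by (meson zero_less_one)
  hence "\<bar>f x\<bar> < 1" if "f \<in> K" "frechet_dist p 0 x < \<delta>" for f x
    using that linear_0[OF lin] by fastforce
  note bound = this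
  obtain i c where "0 < c" "\<And>f. f \<in> K \<Longrightarrow> dominated i c f"
    by (rule dominated_of_bounded_near_zero[of K \<delta>]) (use lin \<open>0 < \<delta>\<close> bound in auto)
  thus ?thesis by (rule that)
qed

lemma dual_imp_dominated:
  assumes f: "f \<in> dual_space p"
  obtains i c where "0 < c" "dominated i c f"
proof -
  have lin: "linear f" using f by (simp add: dual_space_def)
  have "continuous_map ms.mtopology (Met_TC.mtopology) f"
    using f by (simp add: dual_space_def frechet_topology_eq)
  then obtain \<delta> where "0 < \<delta>" "\<And>x. frechet_dist p 0 x < \<delta> \<Longrightarrow> dist (f 0) (f x) < 1"
    by (subst (asm) ms.metric_continuous_map[OF Met_TC.Metric_space_axioms]) (meson UNIV_I zero_less_one)
  hence "\<bar>g x\<bar> < 1" if "g \<in> {f}" "frechet_dist p 0 x < \<delta>" for g x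
    using that linear_0[OF lin] by (fastforce simp: dist_real_def)
  note bound = this
  obtain i c where "0 < c" "\<And>g. g \<in> {f} \<Longrightarrow> dominated i c g"
    by (rule dominated_of_bounded_near_zero[of "{f}" \<delta>]) (use lin \<open>0 < \<delta>\<close> bound in auto)
  thus ?thesis by (intro that) auto
qed

section \<open>Support functions and Hausdorff closeness in one seminorm\<close>

lemma dominated_bdd_above:
  assumes "dominated i c f" "tot_bdd S"
  shows "bdd_above (f ` S)"
proof -
  \<comment> \<open>A net of mesh 1 already bounds \<open>f\<close> on \<open>S\<close>. A real
    supremum carries information only under such a bound, so the support function estimates rest on
    it.\<close>
  obtain F where F: "finite F" "\<And>x. x \<in> S \<Longrightarrow> \<exists>y\<in>F. p i (x - y) < 1"
    using tot_bddD[OF assms(2) zero_less_one] by metis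
  have "f x \<le> (\<Sum>y\<in>F. \<bar>f y\<bar>) + \<bar>c\<bar>" if x: "x \<in> S" for x
  proof -
    obtain y where y: "y \<in> F" "p i (x - y) < 1" using F(2)[OF x] by auto
    have "c * p i (x - y) \<le> \<bar>c\<bar>" 
      using mult_mono[of c "\<bar>c\<bar>" "p i (x - y)" 1] y(2) by simp
    moreover have "\<bar>f y\<bar> \<le> (\<Sum>y\<in>F. \<bar>f y\<bar>)" using y(1) F(1) by (intro member_le_sum) auto
    ultimately show ?thesis using dominated_diff[OF assms(1), of x y] by linarith
  qed
  thus ?thesis by (rule bdd_aboveI2)
qed

lemma support_upper:
  assumes "dominated i c f" "tot_bdd S" "x \<in> S" shows "f x \<le> support_fun f S"
  unfolding support_fun_def by (rule cSUP_upper[OF assms(3) dominated_bdd_above[OF assms(1,2)]])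

lemma support_least: "S \<noteq> {} \<Longrightarrow> (\<And>x. x \<in> S \<Longrightarrow> f x \<le> M) \<Longrightarrow> support_fun f S \<le> M"
  unfolding support_fun_def by (rule cSUP_least)

text \<open>A Hausdorff distance below \<open>e\<close> for the seminorm \<open>p i\<close>, stated
  point by point so that no suprema or infima have to exist.\<close>

definition near :: "nat \<Rightarrow> real \<Rightarrow> 'a set \<Rightarrow> 'a set \<Rightarrow> bool" where
  "near i e A B \<longleftrightarrow> (\<forall>a\<in>A. \<exists>b\<in>B. p i (a - b) < e) \<and> (\<forall>b\<in>B. \<exists>a\<in>A. p i (b - a) < e)"

lemma near_sym: "near i e A B \<Longrightarrow> near i e B A"
  by (auto simp: near_def)

lemma near_trans:
  assumes "near i e A B" "near i e' B C"
  shows "near i (e + e') A C"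
proof -
  have *: "\<exists>c\<in>C. p i (a - c) < e + e'" if ABC: "a \<in> A" "\<forall>a\<in>A. \<exists>b\<in>B. p i (a - b) < e" "\<forall>b\<in>B. \<exists>c\<in>C. p i (b - c) < e'"
    for A B C a e e'
  proof -
    obtain b c where "b \<in> B" "p i (a - b) < e" "c \<in> C" "p i (b - c) < e'" using ABC by blast
    thus ?thesis using p_triangle[of i a c b] by (intro bexI[of _ c]) simp_all
  qed
  show ?thesis
    using *[of _ A B e C e'] *[of _ C B e' A e] assms by (simp add: near_def add.commute)
qed

lemma near_mono:
  assumes "near i e A B" "j \<le> i" "e \<le> e'" shows "near j e' A B"
proof -
  have *: "\<exists>y\<in>Y. p j (x - y) < e'" if xY: "\<exists>y\<in>Y. p i (x - y) < e" for x Y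
  proof -
    obtain y where "y \<in> Y" "p i (x - y) < e" using xY by auto
    thus ?thesis using p_mono[OF assms(2), of "x - y"] assms(3) by (intro bexI[of _ y]) simp_all
  qed
  show ?thesis using assms(1) unfolding near_def by (auto intro: *)
qed

lemma support_near:
  assumes f: "dominated i c f" and c: "0 \<le> c" and A: "A \<noteq> {}" "tot_bdd A" and B: "B \<noteq> {}" "tot_bdd B"
    and near: "near i e A B"
  shows "\<bar>support_fun f A - support_fun f B\<bar> \<le> c * e"
proof -
  have *: "support_fun f A \<le> support_fun f B + c * e"
    if "A \<noteq> {}" and B: "tot_bdd B" and AB: "\<forall>a\<in>A. \<exists>b\<in>B. p i (a - b) < e" for A B
  proof (rule support_least[OF that(1)])
    fix a assume "a \<in> A"
    then obtain b where b: "b \<in> B" "p i (a - b) < e" using AB by auto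
    have "f a - f b \<le> c * p i (a - b)" using dominated_diff[OF f, of a b] by simp
    also have "\<dots> \<le> c * e" using b(2) c by (intro mult_left_mono) auto
    finally show "f a \<le> support_fun f B + c * e"
      using support_upper[OF f B b(1)] by simp
  qed
  show ?thesis using *[OF A(1) B(2)] *[OF B(1) A(2)] near by (fastforce simp: near_def)
qed

text \<open>The converse of \<open>support_near\<close>: a point at \<open>p i\<close>-distance at
  least \<open>e\<close> from a convex set is separated from it, with gap at least \<open>e\<close>,
  by a functional in the polar of \<open>p i\<close>. The constant is preserved because separation
  loses nothing.\<close>

lemma near_of_support:
  assumes A: "A \<noteq> {}" "tot_bdd A" "convex A" and B: "B \<noteq> {}" "tot_bdd B" "convex B"
    and le: "\<And>f. dominated i 1 f \<Longrightarrow> \<bar>support_fun f A - support_fun f B\<bar> < e"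
  shows "near i e A B"
proof -
  have "\<exists>b\<in>B. p i (a - b) < e" if A: "tot_bdd A" and B: "B \<noteq> {}" "convex B" and a: "a \<in> A"
     and le: "\<And>f. dominated i 1 f \<Longrightarrow> support_fun f A < support_fun f B + e" for A B a
  proof (rule ccontr)
    assume "\<not> ?thesis"
    hence "\<And>b. b \<in> B \<Longrightarrow> e \<le> p i (a - b)" by (auto simp: not_less)
    then obtain f where f: "linear f" "\<And>x. \<bar>f x\<bar> \<le> p i x" "\<And>b. b \<in> B \<Longrightarrow> f b + e \<le> f a"
      using seminorm_separation[OF seminorm B(2,1), of e i a] by metis
    hence dom: "dominated i 1 f" by (auto simp: dominated_def)
    have "support_fun f B \<le> f a - e" using f(3) by (intro support_least B) (auto simp: algebra_simps)
    with le[OF dom] support_upper[OF dom A a] show False by simp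
  qed
  from this[OF A(2) B(1,3)] this[OF B(2) A(1,3)] show ?thesis
    unfolding near_def using le by (smt (verit))
qed

end

section \<open>Partitions for Bochner measurable multifunctions\<close>

lemma simple_multifunctionE:
  assumes "simple_multifunction p G"
  obtains m :: nat and A C
  where "\<And>j. j < m \<Longrightarrow> A j \<in> sets lebesgue" "\<And>j. j < m \<Longrightarrow> A j \<subseteq> {0..1}"
    "\<And>j. j < m \<Longrightarrow> C j \<in> cb p" "\<And>j k. j < m \<Longrightarrow> k < m \<Longrightarrow> j \<noteq> k \<Longrightarrow> A j \<inter> A k = {}"
    "\<And>t. t \<in> {0..1} \<Longrightarrow> \<exists>j<m. t \<in> A j" "\<And>j t. j < m \<Longrightarrow> t \<in> A j \<Longrightarrow> G t = C j"
proof -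
  from assms obtain m :: nat and A C where *:
    "(\<forall>j<m. A j \<in> sets lebesgue \<and> A j \<subseteq> {0..1} \<and> C j \<in> cb p)
     \<and> (\<forall>j<m. \<forall>k<m. j \<noteq> k \<longrightarrow> A j \<inter> A k = {})
     \<and> (\<Union>j<m. A j) = {0..1} \<and> (\<forall>j<m. \<forall>t\<in>A j. G t = C j)"
    unfolding simple_multifunction_def by (elim exE)
  have "\<exists>j<m. t \<in> A j" if "t \<in> {0..1}" for t
  proof -
    have "t \<in> (\<Union>j<m. A j)" using * that by (simp only:)
    thus ?thesis by blast
  qed
  with * show ?thesis by (intro that[of m A C]) simp_all
qed

text \<open>Two simple multifunctions realise only finitely many pairs of values, so any relation
  \<open>R\<close> whatsoever selects a finite union of measurable pieces.\<close>

lemma simple_multifunction_measurable: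
  assumes "simple_multifunction p G" "simple_multifunction p G'"
  shows "{t\<in>{0..1}. R (G t) (G' t)} \<in> sets lebesgue"
proof -
  from assms(1) obtain m :: nat and A C where G: "\<And>j. j < m \<Longrightarrow> A j \<in> sets lebesgue"
      "\<And>j. j < m \<Longrightarrow> A j \<subseteq> {0..1}" "\<And>t. t \<in> {0..1} \<Longrightarrow> \<exists>j<m. t \<in> A j"
      "\<And>j t. j < m \<Longrightarrow> t \<in> A j \<Longrightarrow> G t = C j"
    by (rule simple_multifunctionE) (rule that)
  from assms(2) obtain m' :: nat and A' C' where G': "\<And>j. j < m' \<Longrightarrow> A' j \<in> sets lebesgue"
      "\<And>t. t \<in> {0..1} \<Longrightarrow> \<exists>j<m'. t \<in> A' j" "\<And>j t. j < m' \<Longrightarrow> t \<in> A' j \<Longrightarrow> G' t = C' j"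
    by (rule simple_multifunctionE) (rule that)
  define J where "J = {(j, k). j < m \<and> k < m' \<and> R (C j) (C' k)}"
  have "J \<subseteq> {..<m} \<times> {..<m'}" by (auto simp: J_def)
  hence J: "finite J" by (rule finite_subset) simp
  have "{t\<in>{0..1}. R (G t) (G' t)} = (\<Union>(j, k)\<in>J. A j \<inter> A' k)"
  proof (rule set_eqI, rule iffI)
    fix t assume t: "t \<in> {t\<in>{0..1}. R (G t) (G' t)}"
    then obtain j k where j: "j < m" "t \<in> A j" and k: "k < m'" "t \<in> A' k"
      using G(3)[of t] G'(2)[of t] by blast
    have "(j, k) \<in> J" using t G(4)[OF j] G'(3)[OF k] j k by (simp add: J_def)
    thus "t \<in> (\<Union>(j, k)\<in>J. A j \<inter> A' k)" using j k by blast
  next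
    fix t assume "t \<in> (\<Union>(j, k)\<in>J. A j \<inter> A' k)"
    then obtain j k where jk: "(j, k) \<in> J" "t \<in> A j" "t \<in> A' k" by blast
    hence JK: "j < m" "k < m'" "R (C j) (C' k)" by (auto simp: J_def)
    have "t \<in> {0..1}" using jk G(2)[OF JK(1)] by blast
    moreover have "R (G t) (G' t)"
      using JK jk G(4)[OF JK(1) jk(2)] G'(3)[OF JK(2) jk(3)] by simp
    ultimately show "t \<in> {t\<in>{0..1}. R (G t) (G' t)}" by blast
  qed
  also have "\<dots> \<in> sets lebesgue"
    using J G(1) G'(1) by (intro sets.finite_UN) (auto simp: J_def)
  finally show ?thesis .
qed

lemma sets_lebesgue_unit_fmeasurable:
  assumes "E \<in> sets lebesgue" "E \<subseteq> {0..1::real}" shows "E \<in> fmeasurable lebesgue"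
  by (rule fmeasurableI2[of "{0..1}"]) (use assms in auto)

context frechet
begin

lemma INF_frechet_dist_less:
  assumes "B \<noteq> {}" "(INF b\<in>B. frechet_dist p a b) < \<delta>"
  shows "\<exists>b\<in>B. frechet_dist p a b < \<delta>"
proof (rule ccontr)
  assume "\<not> ?thesis"
  hence "\<delta> \<le> (INF b\<in>B. frechet_dist p a b)"
    using assms(1) by (intro cINF_greatest) (auto simp: not_less)
  thus False using assms(2) by simp
qed

lemma hausdorff_dist_less:
  assumes A: "A \<noteq> {}" and B: "B \<noteq> {}" and H: "hausdorff_dist p A B < \<delta>"
  shows "\<forall>a\<in>A. \<exists>b\<in>B. frechet_dist p a b < \<delta>" "\<forall>b\<in>B. \<exists>a\<in>A. frechet_dist p b a < \<delta>"
proof -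
  have *: "\<exists>b\<in>B. frechet_dist p a b < \<delta>"
    if B: "B \<noteq> {}" and a: "a \<in> A" and less: "(SUP a\<in>A. INF b\<in>B. frechet_dist p a b) < \<delta>" for A B a
  proof -
    obtain b0 where b0: "b0 \<in> B" using B by auto
    \<comment> \<open>The metric is bounded by 1, so the suprema in the Hausdorff distance are
      bounded for arbitrary nonempty sets.\<close>
    have bd: "(INF b\<in>B. frechet_dist p a b) \<le> 1" for a
    proof -
      have "bdd_below (frechet_dist p a ` B)" by (rule bdd_belowI2[of _ 0]) simp
      from cINF_lower[OF this b0] frechet_dist_le_1[of a b0] show ?thesis by linarith
    qed
    have "bdd_above ((\<lambda>a. INF b\<in>B. frechet_dist p a b) ` A)" by (rule bdd_aboveI2) (rule bd)
    from cSUP_upper[OF a this] less show ?thesis by (intro INF_frechet_dist_less[OF B]) linarith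
  qed
  have H': "(SUP a\<in>A. INF b\<in>B. frechet_dist p a b) < \<delta>" "(SUP b\<in>B. INF a\<in>A. frechet_dist p b a) < \<delta>"
    using H by (simp_all add: hausdorff_dist_def ms.commute)
  show "\<forall>a\<in>A. \<exists>b\<in>B. frechet_dist p a b < \<delta>" using *[OF B _ H'(1)] by simp
  show "\<forall>b\<in>B. \<exists>a\<in>A. frechet_dist p b a < \<delta>" using *[OF A _ H'(2)] by simp
qed

lemma hausdorff_small_imp_near:
  assumes e: "0 < e"
  obtains \<delta> where "0 < \<delta>"
    "\<And>A B. A \<noteq> {} \<Longrightarrow> B \<noteq> {} \<Longrightarrow> hausdorff_dist p A B < \<delta> \<Longrightarrow> near i e A B"
proof -
  obtain \<delta> where \<delta>: "0 < \<delta>" "\<And>x y. frechet_dist p x y < \<delta> \<Longrightarrow> p i (x - y) < e"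
    using dist_small_imp_p_small[OF e] by metis
  have "near i e A B" if "A \<noteq> {}" "B \<noteq> {}" "hausdorff_dist p A B < \<delta>" for A B
    using hausdorff_dist_less[OF that] \<delta>(2) unfolding near_def by blast
  thus ?thesis by (rule that[OF \<delta>(1)])
qed

text \<open>An Egorov argument: off a set of small measure one \<open>G N\<close> is uniformly
  e/2-close to \<Gamma>. On a piece where \<open>G N\<close> is constant, any two values of \<Gamma>
  are then e-close, and a sampled value can stand in for the constant.\<close>

lemma bochner_measurable_partition:
  assumes \<Gamma>: "\<forall>t\<in>{0..1}. \<Gamma> t \<in> ck p" and bm: "bochner_measurable_mf p \<Gamma>"
    and e: "0 < e" and \<delta>: "0 < \<delta>"
  obtains m :: nat and A :: "nat \<Rightarrow> real set" and c :: "nat \<Rightarrow> real"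
  where "\<And>j. j < m \<Longrightarrow> A j \<in> sets lebesgue" "\<And>j. j < m \<Longrightarrow> A j \<subseteq> {0..1}"
    "\<And>j k. j < m \<Longrightarrow> k < m \<Longrightarrow> j \<noteq> k \<Longrightarrow> A j \<inter> A k = {}" "\<And>j. j < m \<Longrightarrow> c j \<in> {0..1}"
    "measure lebesgue ({0..1} - (\<Union>j<m. A j)) < \<delta>"
    "\<And>j t. j < m \<Longrightarrow> t \<in> A j \<Longrightarrow> near i e (\<Gamma> t) (\<Gamma> (c j))"
proof -
  obtain G where G: "\<And>n. simple_multifunction p (G n)"
    and lim: "AE t in lebesgue_on {0..1}. (\<lambda>n. hausdorff_dist p (G n t) (\<Gamma> t)) \<longlonglongrightarrow> 0"
    using bm unfolding bochner_measurable_mf_def by blast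
  have "AE t in lebesgue. t \<in> {0..1} \<longrightarrow> (\<lambda>n. hausdorff_dist p (G n t) (\<Gamma> t)) \<longlonglongrightarrow> 0"
    using lim by (subst (asm) AE_restrict_space_iff) auto
  then obtain Z where Z: "Z \<in> null_sets lebesgue"
    and good: "\<And>t. t \<in> {0..1} - Z \<Longrightarrow> (\<lambda>n. hausdorff_dist p (G n t) (\<Gamma> t)) \<longlonglongrightarrow> 0"
    by (auto elim!: AE_E3)
  have Gne: "G n t \<noteq> {}" if t: "t \<in> {0..1}" for n t
  proof -
    obtain m :: nat and A C where m: "\<And>j. j < m \<Longrightarrow> C j \<in> cb p" "\<And>t. t \<in> {0..1} \<Longrightarrow> \<exists>j<m. t \<in> A j"
      "\<And>j t. j < m \<Longrightarrow> t \<in> A j \<Longrightarrow> G n t = C j"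
      by (rule simple_multifunctionE[OF G[of n]]) (rule that)
    then obtain j where j: "j < m" "t \<in> A j" using t by blast
    have "G n t \<in> cb p" using m(1)[OF j(1)] m(3)[OF j] by simp
    thus ?thesis by (simp add: cb_def)
  qed
  have \<Gamma>ne: "\<Gamma> t \<noteq> {}" if "t \<in> {0..1}" for t using \<Gamma> that by (auto simp: ck_def)
  have ev: "\<exists>N. \<forall>n\<ge>N. near i (e / 8) (G n t) (\<Gamma> t)" if t: "t \<in> {0..1} - Z" for t
  proof -
    obtain \<eta> where \<eta>: "0 < \<eta>" "\<And>A B. A \<noteq> {} \<Longrightarrow> B \<noteq> {} \<Longrightarrow> hausdorff_dist p A B < \<eta> \<Longrightarrow> near i (e / 8) A B"
      using hausdorff_small_imp_near[of "e / 8" i] e by auto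
    have "eventually (\<lambda>n. hausdorff_dist p (G n t) (\<Gamma> t) < \<eta>) sequentially"
      using good[OF t] \<eta>(1) by (rule order_tendstoD)
    then obtain N where N: "\<And>n. n \<ge> N \<Longrightarrow> hausdorff_dist p (G n t) (\<Gamma> t) < \<eta>"
      unfolding eventually_sequentially by blast
    have "t \<in> {0..1}" using t by simp
    hence "near i (e / 8) (G n t) (\<Gamma> t)" if "n \<ge> N" for n
      by (intro \<eta>(2) Gne \<Gamma>ne N that)
    thus ?thesis by blast
  qed
  \<comment> \<open>Comparing the \<open>G n\<close> with each other rather than with \<open>\<Gamma>\<close> makes \<open>B N\<close> measurable.\<close>
  define B where "B N = {0..1} \<inter> (\<Inter>m. \<Inter>n. {t\<in>{0..1}. N \<le> m \<and> N \<le> n \<longrightarrow> near i (e / 4) (G m t) (G n t)})" for N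
  have Bm: "B N \<in> sets lebesgue" for N
    unfolding B_def
    by (intro sets.Int sets.countable_INT'' simple_multifunction_measurable[OF G G]) auto
  have BD: "near i (e / 4) (G m t) (G n t)" if "t \<in> B N" "N \<le> m" "N \<le> n" for t m n N
    using that by (auto simp: B_def)
  have Bmono: "B N \<subseteq> B N'" if "N \<le> N'" for N N' using that by (auto simp: B_def)
  \<comment> \<open>Off \<open>Z\<close>, two late terms that are e/8-close to \<Gamma> t are
    e/4-close to each other, so \<open>t\<close> enters some \<open>B N\<close>.\<close>
  have Bcover: "(\<Inter>N. {0..1} - B N) \<subseteq> Z"
  proof
    fix t assume t: "t \<in> (\<Inter>N. {0..1} - B N)"
    show "t \<in> Z"
    proof (rule ccontr)
      assume "t \<notin> Z"
      hence "t \<in> {0..1} - Z" using t by auto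
      then obtain N where N: "\<And>n. n \<ge> N \<Longrightarrow> near i (e / 8) (G n t) (\<Gamma> t)" using ev by blast
      have "near i (e / 4) (G m t) (G n t)" if "N \<le> m" "N \<le> n" for m n
        using near_trans[OF N[OF that(1)] near_sym[OF N[OF that(2)]]] by simp
      hence "t \<in> B N" using t by (auto simp: B_def)
      thus False using t by auto
    qed
  qed
  have fm: "{0..1} - B N \<in> fmeasurable lebesgue" for N
    using Bm by (intro sets_lebesgue_unit_fmeasurable) auto
  have "(\<lambda>N. measure lebesgue ({0..1} - B N)) \<longlonglongrightarrow> measure lebesgue (\<Inter>N. {0..1} - B N)"
  proof (rule Lim_measure_decseq)
    show "range (\<lambda>N. {0..1} - B N) \<subseteq> sets lebesgue" using fm by auto
    show "decseq (\<lambda>N. {0..1} - B N)" using Bmono by (force simp: decseq_def)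
    show "emeasure lebesgue ({0..1} - B N) \<noteq> \<infinity>" for N
      using fm[of N] by (auto simp: fmeasurable_def less_top)
  qed
  moreover have "measure lebesgue (\<Inter>N. {0..1} - B N) = 0"
    using Z Bcover completion.complete2[of "\<Inter>N. {0..1} - B N" Z lborel]
    by (auto simp: measure_eq_0_null_sets null_sets_completion_subset)
  ultimately have "eventually (\<lambda>N. measure lebesgue ({0..1} - B N) < \<delta>) sequentially"
    using \<delta> by (intro order_tendstoD(2)) auto
  then obtain N where N: "measure lebesgue ({0..1} - B N) < \<delta>" by (auto simp: eventually_sequentially)
  \<comment> \<open>Removing \<open>Z\<close> ensures convergence at every point of
    \<open>S\<close>, so the comparison of \<open>G N\<close> with later terms passes to \<Gamma>:
    e/4 from \<open>B N\<close> and e/8 from a late index stay below e/2.\<close>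
  define S where "S = B N - Z"
  have Sm: "S \<in> sets lebesgue" using Bm Z by (auto simp: S_def)
  have S1: "S \<subseteq> {0..1}" by (auto simp: S_def B_def)
  have Snear: "near i (e / 2) (\<Gamma> t) (G N t)" if t: "t \<in> S" for t
  proof -
    have "t \<in> {0..1} - Z" using t S1 by (auto simp: S_def)
    then obtain N' where N': "\<And>n. n \<ge> N' \<Longrightarrow> near i (e / 8) (G n t) (\<Gamma> t)" using ev by blast
    have "near i (e / 4) (G N t) (G (max N N') t)" using t by (intro BD[of t N]) (auto simp: S_def)
    from near_trans[OF this N'[of "max N N'"]] have "near i (e / 2) (G N t) (\<Gamma> t)"
      using e by (auto elim!: near_mono)
    thus ?thesis by (rule near_sym)
  qed
  obtain m :: nat and A C where A: "\<And>j. j < m \<Longrightarrow> A j \<in> sets lebesgue" "\<And>j. j < m \<Longrightarrow> A j \<subseteq> {0..1}"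
      "\<And>j k. j < m \<Longrightarrow> k < m \<Longrightarrow> j \<noteq> k \<Longrightarrow> A j \<inter> A k = {}" "\<And>t. t \<in> {0..1} \<Longrightarrow> \<exists>j<m. t \<in> A j"
      "\<And>j t. j < m \<Longrightarrow> t \<in> A j \<Longrightarrow> G N t = C j"
    by (rule simple_multifunctionE[OF G[of N]]) (rule that)
  \<comment> \<open>The default 0 only keeps \<open>c j\<close> in the unit interval; on an empty
    piece the closeness condition is vacuous.\<close>
  define c where "c j = (if A j \<inter> S = {} then 0 else SOME t. t \<in> A j \<inter> S)" for j
  have c: "c j \<in> A j \<inter> S" if "t \<in> A j \<inter> S" for j t
    using that someI[of "\<lambda>t. t \<in> A j \<inter> S" t] by (auto simp: c_def)
  show ?thesis
  proof (rule that[of m "\<lambda>j. A j \<inter> S" c])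
    show "c j \<in> {0..1}" if "j < m" for j
    proof (cases "A j \<inter> S = {}")
      case True thus ?thesis by (simp add: c_def)
    next
      case False
      then obtain t where "t \<in> A j \<inter> S" by blast
      from c[OF this] S1 show ?thesis by blast
    qed
    have "{0..1} - (\<Union>j<m. A j \<inter> S) = ({0..1} - B N) \<union> (Z \<inter> {0..1})"
      using A(4) unfolding S_def by blast
    moreover have "measure lebesgue (({0..1} - B N) \<union> (Z \<inter> {0..1})) = measure lebesgue ({0..1} - B N)"
      using Bm Z by (intro measure_Un_null_set null_set_Int2) auto
    ultimately show "measure lebesgue ({0..1} - (\<Union>j<m. A j \<inter> S)) < \<delta>" using N by simp
    show "near i e (\<Gamma> t) (\<Gamma> (c j))" if j: "j < m" and t: "t \<in> A j \<inter> S" for j t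
    proof -
      have cj: "c j \<in> A j \<inter> S" by (rule c[OF t])
      have "near i (e / 2) (\<Gamma> t) (C j)" using Snear[of t] A(5)[of j t] j t by simp
      moreover have "near i (e / 2) (\<Gamma> (c j)) (C j)" using Snear[of "c j"] A(5)[of j "c j"] j cj by simp
      ultimately show ?thesis using near_trans[OF _ near_sym] by fastforce
    qed
    show "A j \<inter> S \<in> sets lebesgue" if "j < m" for j using A(1)[OF that] Sm by (rule sets.Int)
    show "A j \<inter> S \<subseteq> {0..1}" if "j < m" for j using A(2)[OF that] by blast
    show "(A j \<inter> S) \<inter> (A k \<inter> S) = {}" if "j < m" "k < m" "j \<noteq> k" for j k using A(3)[OF that] by blast
  qed
qed

text \<open>Finite nets of the sampled values are nets for all values of \<Gamma> on the pieces.
  Letting mesh and exceptional measure run through null sequences gives \<open>D\<close> and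
  \<open>Z\<close>, which may depend on \<open>i\<close>.\<close>

lemma bochner_measurable_essentially_separable:
  assumes \<Gamma>: "\<forall>t\<in>{0..1}. \<Gamma> t \<in> ck p" and bm: "bochner_measurable_mf p \<Gamma>"
  obtains D Z where "countable D" "Z \<in> null_sets lebesgue"
    "\<And>t x e. t \<in> {0..1} - Z \<Longrightarrow> x \<in> \<Gamma> t \<Longrightarrow> 0 < e \<Longrightarrow> \<exists>y\<in>D. p i (x - y) < e"
proof -
  have step: "\<exists>S F. S \<in> sets lebesgue \<and> S \<subseteq> {0..1} \<and> measure lebesgue ({0..1} - S) < \<delta> \<and> finite F \<and>
      (\<forall>t\<in>S. \<forall>x\<in>\<Gamma> t. \<exists>y\<in>F. p i (x - y) < e)" if e: "0 < e" and \<delta>: "0 < \<delta>" for e \<delta>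
  proof -
    have e2: "0 < e / 2" using e by simp
    obtain m :: nat and A and c
      where A: "\<And>j. j < m \<Longrightarrow> A j \<in> sets lebesgue" "\<And>j. j < m \<Longrightarrow> A j \<subseteq> {0..1}"
        and c: "\<And>j. j < m \<Longrightarrow> c j \<in> {0..1}"
        and small: "measure lebesgue ({0..1} - (\<Union>j<m. A j)) < \<delta>"
        and near: "\<And>j t. j < m \<Longrightarrow> t \<in> A j \<Longrightarrow> near i (e / 2) (\<Gamma> t) (\<Gamma> (c j))"
      using bochner_measurable_partition[OF \<Gamma> bm e2 \<delta>, of i] by metis
    have "\<exists>F. finite F \<and> (\<forall>x\<in>\<Gamma> (c j). \<exists>y\<in>F. p i (x - y) < e / 2)" if j: "j < m" for j
    proof -
      have "tot_bdd (\<Gamma> (c j))" using c[OF j] \<Gamma> by (auto intro: ck_tot_bdd)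
      from tot_bddD[OF this e2, of i] show ?thesis by metis
    qed
    then obtain F where F: "\<And>j. j < m \<Longrightarrow> finite (F j)"
        "\<And>j x. j < m \<Longrightarrow> x \<in> \<Gamma> (c j) \<Longrightarrow> \<exists>y\<in>F j. p i (x - y) < e / 2" by metis
    have "\<exists>y\<in>(\<Union>j<m. F j). p i (x - y) < e" if t: "t \<in> (\<Union>j<m. A j)" and x: "x \<in> \<Gamma> t" for t x
    proof -
      obtain j where j: "j < m" "t \<in> A j" using t by auto
      obtain z where z: "z \<in> \<Gamma> (c j)" "p i (x - z) < e / 2" using near[OF j] x by (auto simp: near_def)
      obtain y where y: "y \<in> F j" "p i (z - y) < e / 2" using F(2)[OF j(1) z(1)] by auto
      show ?thesis using p_triangle[of i x y z] y z j by (intro bexI[of _ y]) auto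
    qed
    note net = this
    have "(\<Union>j<m. A j) \<in> sets lebesgue" using A(1) by (intro sets.finite_UN) auto
    moreover have "(\<Union>j<m. A j) \<subseteq> {0..1}" using A(2) by blast
    moreover have "finite (\<Union>j<m. F j)" using F(1) by auto
    ultimately show ?thesis using small net
      by (intro exI[of _ "\<Union>j<m. A j"] exI[of _ "\<Union>j<m. F j"]) (intro conjI ballI)
  qed
  define Q where "Q k l S F \<longleftrightarrow> S \<in> sets lebesgue \<and> S \<subseteq> {0..1} \<and>
      measure lebesgue ({0..1} - S) < 1 / real (Suc l) \<and> finite F \<and>
      (\<forall>t\<in>S. \<forall>x\<in>\<Gamma> t. \<exists>y\<in>F. p i (x - y) < 1 / real (Suc k))" for k l S F
  have "\<exists>S F. Q k l S F" for k l
    unfolding Q_def by (rule step) auto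
  then obtain S F where "\<And>k l. Q k l (S k l) (F k l)" by metis
  hence S: "\<And>k l. S k l \<in> sets lebesgue" "\<And>k l. S k l \<subseteq> {0..1}"
      "\<And>k l. measure lebesgue ({0..1} - S k l) < 1 / real (Suc l)" and F: "\<And>k l. finite (F k l)"
      "\<And>k l t x. t \<in> S k l \<Longrightarrow> x \<in> \<Gamma> t \<Longrightarrow> \<exists>y\<in>F k l. p i (x - y) < 1 / real (Suc k)"
    by (simp_all add: Q_def)
  \<comment> \<open>For fixed \<open>k\<close> the complements have measure below 1/(l + 1), so the
    points avoiding every \<open>S k l\<close> form a null set. A point outside \<open>Z\<close> has
    a finite net at every mesh 1/(k + 1).\<close>
  define Z where "Z = (\<Union>k. \<Inter>l. {0..1} - S k l)"
  have "(\<Inter>l. {0..1} - S k l) \<in> null_sets lebesgue" for k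
  proof -
    have m: "{0..1} - S k l \<in> fmeasurable lebesgue" for l
      using S by (intro sets_lebesgue_unit_fmeasurable) auto
    have ms: "(\<Inter>l. {0..1} - S k l) \<in> sets lebesgue" using S(1) by (intro sets.countable_INT'') auto
    have "measure lebesgue (\<Inter>l. {0..1} - S k l) < 1 / real (Suc l)" for l
      using measure_mono_fmeasurable[of "\<Inter>l. {0..1} - S k l" "{0..1} - S k l" lebesgue, OF _ ms m] S(3)[of k l]
      by force
    hence "measure lebesgue (\<Inter>l. {0..1} - S k l) \<le> 0"
      using reals_Archimedean[of "measure lebesgue (\<Inter>l. {0..1} - S k l)"]
      by (metis inverse_eq_divide less_imp_not_less not_le)
    hence 0: "measure lebesgue (\<Inter>l. {0..1} - S k l) = 0" by (simp add: measure_le_0_iff)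
    have "(\<Inter>l. {0..1} - S k l) \<in> fmeasurable lebesgue"
      using ms by (intro sets_lebesgue_unit_fmeasurable) auto
    with 0 ms show ?thesis by (intro null_setsI) (simp_all add: emeasure_eq_measure2)
  qed
  hence "Z \<in> null_sets lebesgue" unfolding Z_def by (intro null_sets_UN)
  moreover have "countable (\<Union>k. \<Union>l. F k l)" using F(1) by (intro countable_UN) (auto intro: countable_finite)
  moreover have "\<exists>y\<in>(\<Union>k. \<Union>l. F k l). p i (x - y) < e" if t: "t \<in> {0..1} - Z" and x: "x \<in> \<Gamma> t" and e: "0 < e" for t x e
  proof -
    obtain k where k: "1 / real (Suc k) < e" using reals_Archimedean[OF e] by (auto simp: inverse_eq_divide)
    obtain l where "t \<in> S k l" using t by (auto simp: Z_def)
    from F(2)[OF this x] obtain y where "y \<in> F k l" "p i (x - y) < 1 / real (Suc k)" by auto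
    thus ?thesis using k by (intro bexI[of _ y]) auto
  qed
  ultimately show ?thesis using that by metis
qed

end

section \<open>Minkowski sums and completeness of ck\<close>

context frechet
begin

lemma dominated_mono:
  assumes "dominated i c f" "i \<le> j" "0 \<le> c" "c \<le> c'" shows "dominated j c' f"
  unfolding dominated_def
proof (intro conjI allI)
  show "linear f" by (rule dominated_linear[OF assms(1)])
  fix x
  have "\<bar>f x\<bar> \<le> c * p i x" by (rule dominated_bound[OF assms(1)])
  also have "\<dots> \<le> c' * p j x" using assms p_mono by (intro mult_mono) auto
  finally show "\<bar>f x\<bar> \<le> c' * p j x" .
qed

lemma dominated_divide:
  assumes "dominated i c f" "0 < c" shows "dominated i 1 (\<lambda>x. f x / c)"
  unfolding dominated_def
proof (intro conjI allI)
  show "linear (\<lambda>x. f x / c)"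
    using dominated_linear[OF assms(1)] by (auto simp: linear_iff add_divide_distrib)
  show "\<bar>f x / c\<bar> \<le> 1 * p i x" for x
    using dominated_bound[OF assms(1), of x] assms(2) by (simp add: divide_le_eq mult.commute)
qed

lemma support_divide:
  assumes f: "dominated i c f" and S: "S \<noteq> {}" "tot_bdd S" and c: "0 < c"
  shows "support_fun (\<lambda>x. f x / c) S = support_fun f S / c"
proof (rule antisym)
  show "support_fun (\<lambda>x. f x / c) S \<le> support_fun f S / c"
    using support_upper[OF f S(2)] c by (intro support_least S divide_right_mono) auto
  have "f x \<le> support_fun (\<lambda>x. f x / c) S * c" if "x \<in> S" for x
    using support_upper[OF dominated_divide[OF f c] S(2) that] c by (simp add: field_simps)
  hence "support_fun f S \<le> support_fun (\<lambda>x. f x / c) S * c" by (intro support_least S)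
  thus "support_fun f S / c \<le> support_fun (\<lambda>x. f x / c) S" using c by (simp add: divide_le_eq)
qed

text \<open>Closedness is left out of the approximants, so Minkowski sums can be formed without
  taking closures; the limit set in \<open>ck_limit\<close> is closed again.\<close>

definition precompact_convex :: "'a set \<Rightarrow> bool" where
  "precompact_convex S \<longleftrightarrow> S \<noteq> {} \<and> convex S \<and> tot_bdd S"

lemma ck_precompact_convex: "C \<in> ck p \<Longrightarrow> precompact_convex C"
  using ck_tot_bdd by (simp add: precompact_convex_def ck_def)

lemma precompact_convex_add_scaled:
  assumes S: "precompact_convex S" and C: "precompact_convex C" and w: "0 \<le> w"
  obtains T where "precompact_convex T"
    "\<And>i c f. dominated i c f \<Longrightarrow> support_fun f T = support_fun f S + w * support_fun f C"
proof -
  define T where "T = {x + w *\<^sub>R y | x y. x \<in> S \<and> y \<in> C}"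
  have Sn: "S \<noteq> {}" "convex S" "tot_bdd S" and Cn: "C \<noteq> {}" "convex C" "tot_bdd C"
    using S C by (auto simp: precompact_convex_def)
  have TI: "x + w *\<^sub>R y \<in> T" if "x \<in> S" "y \<in> C" for x y using that by (auto simp: T_def)
  have ne: "T \<noteq> {}" using Sn(1) Cn(1) TI by blast
  have "convex T"
  proof (rule convexI)
    fix a b and u v :: real
    assume ab: "a \<in> T" "b \<in> T" and uv: "0 \<le> u" "0 \<le> v" "u + v = 1"
    obtain x y where a: "a = x + w *\<^sub>R y" "x \<in> S" "y \<in> C" using ab(1) by (auto simp: T_def)
    obtain x' y' where b: "b = x' + w *\<^sub>R y'" "x' \<in> S" "y' \<in> C" using ab(2) by (auto simp: T_def)
    have "u *\<^sub>R a + v *\<^sub>R b = (u *\<^sub>R x + v *\<^sub>R x') + w *\<^sub>R (u *\<^sub>R y + v *\<^sub>R y')"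
      by (simp add: a b algebra_simps)
    also have "\<dots> \<in> T"
      by (intro TI convexD[OF Sn(2)] convexD[OF Cn(2)] a b uv)
    finally show "u *\<^sub>R a + v *\<^sub>R b \<in> T" .
  qed
  moreover have "tot_bdd T"
  proof (rule tot_bddI)
    fix i and e :: real assume e: "0 < e"
    \<comment> \<open>The net of \<open>C\<close> is scaled by \<open>w\<close>, which turns its
      mesh into at most e/2; adding 1 covers \<open>w = 0\<close>.\<close>
    hence e2: "0 < e / 2" and e3: "0 < e / (2 * (w + 1))" using w by auto
    obtain F where F: "finite F" "\<And>x. x \<in> S \<Longrightarrow> \<exists>y\<in>F. p i (x - y) < e / 2"
      using tot_bddD[OF Sn(3) e2] by metis
    obtain F' where F': "finite F'" "\<And>x. x \<in> C \<Longrightarrow> \<exists>y\<in>F'. p i (x - y) < e / (2 * (w + 1))"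
      using tot_bddD[OF Cn(3) e3] by metis
    let ?F = "(\<lambda>(x, y). x + w *\<^sub>R y) ` (F \<times> F')"
    have "\<exists>z\<in>?F. p i (a - z) < e" if a: "a \<in> T" for a
    proof -
      obtain x y where xy: "a = x + w *\<^sub>R y" "x \<in> S" "y \<in> C" using a by (auto simp: T_def)
      obtain x' where x': "x' \<in> F" "p i (x - x') < e / 2" using F(2)[OF xy(2)] by auto
      obtain y' where y': "y' \<in> F'" "p i (y - y') < e / (2 * (w + 1))" using F'(2)[OF xy(3)] by auto
      have "p i (a - (x' + w *\<^sub>R y')) = p i ((x - x') + w *\<^sub>R (y - y'))"
        by (simp add: xy algebra_simps)
      also have "\<dots> \<le> p i (x - x') + w * p i (y - y')"
        using p_add[of i "x - x'" "w *\<^sub>R (y - y')"] w by (simp add: p_scale)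
      also have "w * p i (y - y') \<le> w * (e / (2 * (w + 1)))"
        using y'(2) w by (intro mult_left_mono) auto
      also have "\<dots> \<le> e / 2" using w e by (simp add: field_simps)
      finally have "p i (a - (x' + w *\<^sub>R y')) < e" using x'(2) by simp
      thus ?thesis using x'(1) y'(1) by force
    qed
    thus "\<exists>j F. i \<le> j \<and> finite F \<and> (\<forall>x\<in>T. \<exists>y\<in>F. p j (x - y) < e)"
      using F(1) F'(1) by (intro exI[of _ i] exI[of _ ?F]) auto
  qed
  ultimately have T: "precompact_convex T" using ne by (simp add: precompact_convex_def)
  have "support_fun f T = support_fun f S + w * support_fun f C" if f: "dominated i c f" for i c f
  proof (rule antisym)
    have lin: "f (x + w *\<^sub>R y) = f x + w * f y" for x y
      using dominated_linear[OF f] by (simp add: linear_add linear_scale)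
    show "support_fun f T \<le> support_fun f S + w * support_fun f C"
    proof (rule support_least[OF ne])
      fix a assume "a \<in> T"
      then obtain x y where xy: "a = x + w *\<^sub>R y" "x \<in> S" "y \<in> C" by (auto simp: T_def)
      show "f a \<le> support_fun f S + w * support_fun f C" unfolding xy(1) lin
        by (intro add_mono mult_left_mono support_upper[OF f] Sn Cn xy w)
    qed
    have "f x + w * f y \<le> support_fun f T" if "x \<in> S" "y \<in> C" for x y
      using support_upper[OF f _ TI[OF that]] T lin[of x y] by (simp add: precompact_convex_def)
    \<comment> \<open>The suprema over \<open>S\<close> and \<open>C\<close> are taken one after the
      other; the second requires dividing by \<open>w\<close>, hence the case distinction.\<close>
    hence *: "support_fun f S \<le> support_fun f T - w * f y" if "y \<in> C" for y
      using that by (intro support_least Sn) (simp add: algebra_simps)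
    show "support_fun f S + w * support_fun f C \<le> support_fun f T"
    proof (cases "w = 0")
      case True
      obtain y where "y \<in> C" using Cn(1) by auto
      from *[OF this] True show ?thesis by simp
    next
      case False
      with w have w': "0 < w" by simp
      have "support_fun f C \<le> (support_fun f T - support_fun f S) / w"
      proof (rule support_least[OF Cn(1)])
        fix y assume "y \<in> C"
        from *[OF this] show "f y \<le> (support_fun f T - support_fun f S) / w"
          using w' by (simp add: pos_le_divide_eq mult.commute)
      qed
      thus ?thesis using w' by (simp add: pos_le_divide_eq mult.commute)
    qed
  qed
  thus ?thesis by (rule that[OF T])
qed

lemma precompact_convex_weighted_sum:
  fixes m :: nat
  assumes "\<And>j. j < m \<Longrightarrow> precompact_convex (C j)" "\<And>j. j < m \<Longrightarrow> 0 \<le> w j"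
  shows "\<exists>T. precompact_convex T \<and>
    (\<forall>i c f. dominated i c f \<longrightarrow> support_fun f T = (\<Sum>j<m. w j * support_fun f (C j)))"
  using assms
proof (induction m)
  case 0
  have "tot_bdd {0}" by (rule tot_bddI) (auto intro!: exI[of _ "{0}"])
  hence "precompact_convex {0}" by (simp add: precompact_convex_def)
  moreover have "support_fun f {0} = 0" if "dominated i c f" for i c f
    using linear_0[OF dominated_linear[OF that]] by (simp add: support_fun_def)
  ultimately show ?case by (intro exI[of _ "{0}"]) auto
next
  case (Suc m)
  then obtain S where S: "precompact_convex S"
      "\<And>i c f. dominated i c f \<Longrightarrow> support_fun f S = (\<Sum>j<m. w j * support_fun f (C j))"
    by (metis less_Suc_eq)
  obtain T where T: "precompact_convex T"
      "\<And>i c f. dominated i c f \<Longrightarrow> support_fun f T = support_fun f S + w m * support_fun f (C m)"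
    by (rule precompact_convex_add_scaled[OF S(1), of "C m" "w m"]) (use Suc.prems in auto)
  show ?case by (rule exI[of _ T]) (simp add: T S(2))
qed

text \<open>Each step is measured in its own seminorm, yet every fixed \<open>p i\<close> is
  controlled, since \<open>p i \<le> p n\<close> for later \<open>n\<close>. The geometric tail
  gives the factor 2.\<close>

lemma p_limit:
  assumes y: "\<And>j. k \<le> j \<Longrightarrow> p j (y j - y (Suc j)) < (1/2) ^ j"
  shows "\<exists>x. \<forall>j\<ge>k. p j (y j - x) \<le> 2 * (1/2) ^ j"
proof -
  \<comment> \<open>The subtracted term makes the induction close: a step of size (1/2)^(n + l) is
    exactly what halving it releases.\<close>
  have step: "p j (y n - y (n + l)) \<le> 2 * (1/2) ^ n - 2 * (1/2) ^ (n + l)" if n: "k \<le> n" "j \<le> n" for j n l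
  proof (induction l)
    case (Suc l)
    have "p j (y (n + l) - y (Suc (n + l))) \<le> p (n + l) (y (n + l) - y (Suc (n + l)))"
      using n by (intro p_mono) auto
    also have "\<dots> \<le> (1/2) ^ (n + l)" using y[of "n + l"] n by simp
    finally show ?case
      using p_triangle[of j "y n" "y (Suc (n + l))" "y (n + l)"] Suc.IH by simp
  qed simp
  have step': "p j (y n - y m) \<le> 2 * (1/2) ^ n" if "k \<le> n" "j \<le> n" "n \<le> m" for j n m
  proof -
    have "p j (y n - y m) \<le> 2 * (1/2) ^ n - 2 * (1/2) ^ m"
      using step[OF that(1,2), of "m - n"] that(3) by simp
    thus ?thesis using zero_le_power[of "1/2::real" m] by linarith
  qed
  have "ms.MCauchy y"
    unfolding ms.MCauchy_def
  proof (intro conjI allI impI)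
    fix e :: real assume "0 < e"
    then obtain i \<delta> where i: "0 < \<delta>" "\<And>x y. p i (x - y) < \<delta> \<Longrightarrow> frechet_dist p x y < e"
      using p_small_imp_dist_small by metis
    obtain n0 where n0: "(1/2::real) ^ n0 < \<delta> / 4" using real_arch_pow_inv[of "\<delta> / 4" "1/2"] i(1) by auto
    define N where "N = max n0 (max k i)"
    have "(1/2::real) ^ N \<le> (1/2) ^ n0" by (intro power_decreasing) (auto simp: N_def)
    hence N: "(1/2::real) ^ N < \<delta> / 4" using n0 by (rule order_le_less_trans)
    have "frechet_dist p (y n) (y n') < e" if "N \<le> n" "N \<le> n'" for n n'
    proof (rule i(2))
      have "p i (y N - y n) \<le> 2 * (1/2) ^ N" "p i (y N - y n') \<le> 2 * (1/2) ^ N"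
        using that by (intro step'; simp add: N_def)+
      thus "p i (y n - y n') < \<delta>"
        using N p_triangle[of i "y n" "y n'" "y N"] p_minus_commute[of i "y n" "y N"] by simp
    qed
    thus "\<exists>N. \<forall>n n'. N \<le> n \<longrightarrow> N \<le> n' \<longrightarrow> frechet_dist p (y n) (y n') < e" by blast
  qed simp
  then obtain x where x: "limitin ms.mtopology y x sequentially"
    using mcomplete unfolding ms.mcomplete_def by blast
  have "p j (y j - x) \<le> 2 * (1/2) ^ j" if j: "k \<le> j" for j
  proof (rule field_le_epsilon)
    fix e :: real assume "0 < e"
    then obtain \<delta> where \<delta>: "0 < \<delta>" "\<And>x y. frechet_dist p x y < \<delta> \<Longrightarrow> p j (x - y) < e"
      using dist_small_imp_p_small by metis
    obtain N where N: "\<And>n. n \<ge> N \<Longrightarrow> frechet_dist p (y n) x < \<delta>"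
      using x \<delta>(1) unfolding ms.limit_metric_sequentially by blast
    have "p j (y (max N j) - x) < e" by (intro \<delta>(2) N) simp
    moreover have "p j (y j - y (max N j)) \<le> 2 * (1/2) ^ j" using j by (intro step') auto
    ultimately show "p j (y j - x) \<le> 2 * (1/2) ^ j + e"
      using p_triangle[of j "y j" x "y (max N j)"] by simp
  qed
  thus ?thesis by blast
qed

text \<open>The limit consists of the limits of sequences selected from the \<open>I n\<close>.\<close>

lemma ck_limit:
  assumes I: "\<And>n. precompact_convex (I n)" and near: "\<And>n. near n ((1/2) ^ n) (I n) (I (Suc n))"
  obtains J where "J \<in> ck p" "\<And>n. near n (4 * (1/2) ^ n) J (I n)"
proof -
  have In: "I n \<noteq> {}" "convex (I n)" "tot_bdd (I n)" for n
    using I[of n] by (auto simp: precompact_convex_def)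
  \<comment> \<open>The lower limit of the sets \<open>I n\<close>: points whose distance to
    \<open>I n\<close> tends to 0 in every seminorm.\<close>
  define J where "J = {x. \<forall>i. \<forall>e>0. \<exists>N. \<forall>n\<ge>N. \<exists>y\<in>I n. p i (x - y) < e}"
  have far: "\<exists>a\<in>I n. p n (b - a) < 2 * (1/2) ^ n" if b: "b \<in> I (n + l)" for n l b
  proof -
    have "\<exists>a\<in>I n. p n (b - a) \<le> 2 * (1/2) ^ n - 2 * (1/2) ^ (n + l)" if "b \<in> I (n + l)" for b
      using that
    proof (induction l arbitrary: b)
      case 0 thus ?case by (intro bexI[of _ b]) auto
    next
      case (Suc l)
      have nr: "\<forall>b\<in>I (Suc (n + l)). \<exists>a\<in>I (n + l). p (n + l) (b - a) < (1/2) ^ (n + l)"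
        using near[of "n + l"] unfolding near_def by blast
      obtain b' where b': "b' \<in> I (n + l)" "p (n + l) (b - b') < (1/2) ^ (n + l)"
        using nr Suc.prems by auto
      obtain a where a: "a \<in> I n" "p n (b' - a) \<le> 2 * (1/2) ^ n - 2 * (1/2) ^ (n + l)"
        using Suc.IH[OF b'(1)] by auto
      have "p n (b - a) \<le> 2 * (1/2) ^ n - 2 * (1/2) ^ (n + Suc l)"
        using a(2) b'(2) p_mono[of n "n + l" "b - b'"] p_triangle[of n b a b'] by simp
      thus ?case using a(1) by blast
    qed
    from this[OF b] obtain a where a: "a \<in> I n" "p n (b - a) \<le> 2 * (1/2) ^ n - 2 * (1/2) ^ (n + l)" by auto
    have "0 < (1/2::real) ^ (n + l)" by (rule zero_less_power) simp
    with a(2) have "p n (b - a) < 2 * (1/2) ^ n" by linarith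
    thus ?thesis using a(1) by blast
  qed
  \<comment> \<open>A point of \<open>J\<close> is within 2^-n of a later set, whose points are
    within 2 * 2^-n of \<open>I n\<close>; the constant 4 leaves room and serves the other direction
    as well.\<close>
  have JI: "\<exists>a\<in>I n. p n (x - a) < 4 * (1/2) ^ n" if x: "x \<in> J" for x n
  proof -
    have "0 < (1/2::real) ^ n" by (rule zero_less_power) simp
    then obtain N where N: "\<forall>m\<ge>N. \<exists>y\<in>I m. p n (x - y) < (1/2) ^ n"
      using x unfolding J_def by blast
    moreover have "N \<le> n + N" by simp
    ultimately obtain y where y: "y \<in> I (n + N)" "p n (x - y) < (1/2) ^ n" by blast
    obtain a where a: "a \<in> I n" "p n (y - a) < 2 * (1/2) ^ n" using far[OF y(1)] by auto
    have "p n (x - a) < 4 * (1/2) ^ n"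
      using p_triangle[of n x a y] y(2) a(2) \<open>0 < (1/2::real) ^ n\<close> by linarith
    thus ?thesis using a(1) by blast
  qed
  have IJ: "\<exists>x\<in>J. p n (a - x) < 4 * (1/2) ^ n" if a: "a \<in> I n" for a n
  proof -
    \<comment> \<open>A forward selection: starting from \<open>a\<close> at level \<open>n\<close>,
      each level supplies a point close to the previous one, and \<open>p_limit\<close> yields the
      required point of \<open>J\<close>.\<close>
    define nxt where "nxt j y = (SOME z. z \<in> I (Suc j) \<and> p j (y - z) < (1/2) ^ j)" for j y
    have nxt: "nxt j y \<in> I (Suc j)" "p j (y - nxt j y) < (1/2) ^ j" if y: "y \<in> I j" for j y
    proof -
      have "\<exists>z. z \<in> I (Suc j) \<and> p j (y - z) < (1/2) ^ j"
        using near[of j] y unfolding near_def by blast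
      from someI_ex[OF this] show "nxt j y \<in> I (Suc j)" "p j (y - nxt j y) < (1/2) ^ j"
        by (simp_all add: nxt_def)
    qed
    define z where "z = rec_nat a (\<lambda>l y. nxt (n + l) y)"
    have z0: "z 0 = a" and zS: "z (Suc l) = nxt (n + l) (z l)" for l by (simp_all add: z_def)
    have zI: "z l \<in> I (n + l)" for l by (induction l) (auto simp: z0 zS a nxt(1))
    \<comment> \<open>Reindexing by level, with \<open>y n = a\<close>; below \<open>n\<close> the
      truncated subtraction gives \<open>a\<close>, and those indices do not enter the
      limit.\<close>
    define y where "y j = z (j - n)" for j
    have yI: "y j \<in> I j" if "n \<le> j" for j using zI[of "j - n"] that by (simp add: y_def)
    have ystep: "p j (y j - y (Suc j)) < (1/2) ^ j" if "n \<le> j" for j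
      using nxt(2)[OF zI[of "j - n"]] zS[of "j - n"] that by (simp add: y_def Suc_diff_le)
    obtain x where x: "\<And>j. n \<le> j \<Longrightarrow> p j (y j - x) \<le> 2 * (1/2) ^ j"
      using p_limit[of n y] ystep by blast
    have "x \<in> J"
      unfolding J_def
    proof (intro CollectI allI impI)
      fix i and e :: real assume "0 < e"
      then obtain n0 where n0: "(1/2::real) ^ n0 < e / 2" using real_arch_pow_inv[of "e / 2" "1/2"] by auto
      have "\<exists>y\<in>I m. p i (x - y) < e" if m: "max n0 (max n i) \<le> m" for m
      proof -
        have "p i (x - y m) \<le> p m (y m - x)" using p_mono[of i m] m p_minus_commute by simp
        also have "\<dots> \<le> 2 * (1/2) ^ m" using m by (intro x) auto
        also have "(1/2::real) ^ m \<le> (1/2) ^ n0" using m by (intro power_decreasing) auto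
        finally have "p i (x - y m) < e" using n0 by simp
        thus ?thesis using yI[of m] m by auto
      qed
      thus "\<exists>N. \<forall>m\<ge>N. \<exists>y\<in>I m. p i (x - y) < e" by blast
    qed
    have "0 < (1/2::real) ^ n" by (rule zero_less_power) simp
    moreover have "p n (a - x) \<le> 2 * (1/2) ^ n" using x[of n] by (simp add: y_def z0)
    ultimately have "p n (a - x) < 4 * (1/2) ^ n" by linarith
    with \<open>x \<in> J\<close> show ?thesis by blast
  qed
  have "J \<in> ck p"
  proof (rule ckI)
    obtain a where "a \<in> I 0" using In(1)[of 0] by auto
    thus "J \<noteq> {}" using IJ by blast
    show "convex J"
    proof (rule convexI)
      fix x x' and u v :: real assume xx: "x \<in> J" "x' \<in> J" and uv: "0 \<le> u" "0 \<le> v" "u + v = 1"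
      show "u *\<^sub>R x + v *\<^sub>R x' \<in> J"
        unfolding J_def
      proof (intro CollectI allI impI)
        fix i and e :: real assume e: "0 < e"
        obtain N where N: "\<And>n. n \<ge> N \<Longrightarrow> \<exists>y\<in>I n. p i (x - y) < e"
          using xx(1) e unfolding J_def by blast
        obtain N' where N': "\<And>n. n \<ge> N' \<Longrightarrow> \<exists>y\<in>I n. p i (x' - y) < e"
          using xx(2) e unfolding J_def by blast
        have "\<exists>y\<in>I n. p i ((u *\<^sub>R x + v *\<^sub>R x') - y) < e" if n: "max N N' \<le> n" for n
        proof -
          obtain y where y: "y \<in> I n" "p i (x - y) < e" using N[of n] n by auto
          obtain y' where y': "y' \<in> I n" "p i (x' - y') < e" using N'[of n] n by auto
          have "(u *\<^sub>R x + v *\<^sub>R x') - (u *\<^sub>R y + v *\<^sub>R y') = u *\<^sub>R (x - y) + v *\<^sub>R (x' - y')"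
            by (simp add: algebra_simps)
          hence "p i ((u *\<^sub>R x + v *\<^sub>R x') - (u *\<^sub>R y + v *\<^sub>R y')) \<le> u * p i (x - y) + v * p i (x' - y')"
            using p_add[of i "u *\<^sub>R (x - y)" "v *\<^sub>R (x' - y')"] uv by (simp add: p_scale)
          also have "\<dots> < e" using convex_bound_lt[OF y(2) y'(2) uv] .
          finally show ?thesis using convexD[OF In(2) y(1) y'(1) uv] by blast
        qed
        thus "\<exists>N. \<forall>n\<ge>N. \<exists>y\<in>I n. p i ((u *\<^sub>R x + v *\<^sub>R x') - y) < e" by blast
      qed
    qed
    show "tot_bdd J"
    proof (rule tot_bddI)
      fix i and e :: real assume e: "0 < e"
      then obtain n0 where n0: "(1/2::real) ^ n0 < e / 8" using real_arch_pow_inv[of "e / 8" "1/2"] by auto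
      define n where "n = max n0 i"
      have "(1/2::real) ^ n \<le> (1/2) ^ n0" by (intro power_decreasing) (auto simp: n_def)
      hence n: "4 * (1/2::real) ^ n < e / 2" using n0 by linarith
      have e2: "0 < e / 2" using e by simp
      obtain F where F: "finite F" "\<And>x. x \<in> I n \<Longrightarrow> \<exists>y\<in>F. p n (x - y) < e / 2"
        using tot_bddD[OF In(3)[of n] e2, of n] by metis
      have "\<exists>y\<in>F. p n (x - y) < e" if x: "x \<in> J" for x
      proof -
        obtain a where a: "a \<in> I n" "p n (x - a) < 4 * (1/2) ^ n" using JI[OF x] by auto
        obtain y where y: "y \<in> F" "p n (a - y) < e / 2" using F(2)[OF a(1)] by auto
        have "p n (x - y) < e" using p_triangle[of n x y a] a(2) y(2) n by linarith
        thus ?thesis using y(1) by blast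
      qed
      thus "\<exists>j F. i \<le> j \<and> finite F \<and> (\<forall>x\<in>J. \<exists>y\<in>F. p j (x - y) < e)"
        using F(1) by (intro exI[of _ n] exI[of _ F]) (auto simp: n_def)
    qed
    fix x assume cl: "\<And>i e. 0 < e \<Longrightarrow> \<exists>y\<in>J. p i (x - y) < e"
    show "x \<in> J"
      unfolding J_def
    proof (intro CollectI allI impI)
      fix i and e :: real assume e: "0 < e"
      hence e2: "0 < e / 2" by simp
      obtain x' where x': "x' \<in> J" "p i (x - x') < e / 2" using cl[OF e2] by blast
      obtain N where N: "\<And>n. n \<ge> N \<Longrightarrow> \<exists>y\<in>I n. p i (x' - y) < e / 2"
        using x'(1) e2 unfolding J_def by blast
      have "\<exists>y\<in>I n. p i (x - y) < e" if n: "N \<le> n" for n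
      proof -
        obtain y where "y \<in> I n" "p i (x' - y) < e / 2" using N[OF n] by auto
        thus ?thesis using p_triangle[of i x y x'] x'(2) by (intro bexI[of _ y]) auto
      qed
      thus "\<exists>N. \<forall>n\<ge>N. \<exists>y\<in>I n. p i (x - y) < e" by blast
    qed
  qed
  moreover have "near n (4 * (1/2) ^ n) J (I n)" for n
    unfolding near_def using JI IJ by blast
  ultimately show ?thesis by (rule that)
qed

end

section \<open>Pettis integrability\<close>

context frechet
begin

text \<open>The candidate is the integral of a step multifunction: value
  \<open>\<Gamma> (c j)\<close> on the part of \<open>E\<close> in \<open>A j\<close>, and 0 off the
  pieces. Both error sources, closeness on the pieces and uniform integrability off them, are
  uniform on the polar of \<open>p i\<close>, so one set works for all \<open>f\<close>.\<close>

lemma approximating_integral: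
  assumes \<Gamma>: "\<forall>t\<in>{0..1}. \<Gamma> t \<in> ck p" and bm: "bochner_measurable_mf p \<Gamma>"
    and int: "\<And>f. f \<in> dual_space p \<Longrightarrow> integrable (lebesgue_on {0..1}) (\<lambda>t. support_fun f (\<Gamma> t))"
    and ui: "\<And>e. 0 < e \<Longrightarrow> \<exists>\<delta>>0. \<forall>E. E \<in> sets lebesgue \<and> E \<subseteq> {0..1} \<and> measure lebesgue E < \<delta> \<longrightarrow>
        (\<forall>f. dominated i 1 f \<longrightarrow> integral\<^sup>L (lebesgue_on E) (\<lambda>t. \<bar>support_fun f (\<Gamma> t)\<bar>) < e)"
    and E: "E \<in> sets lebesgue" "E \<subseteq> {0..1}" and e: "0 < e"
  shows "\<exists>I. precompact_convex I \<and> (\<forall>f. dominated i 1 f \<longrightarrow>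
    \<bar>support_fun f I - integral\<^sup>L (lebesgue_on E) (\<lambda>t. support_fun f (\<Gamma> t))\<bar> < e)"
proof -
  let ?M = "lebesgue_on {0..1::real}"
  interpret M: finite_measure ?M by (rule finite_measure_unit)
  have e2: "0 < e / 2" using e by simp
  from ui[OF e2] obtain \<delta> where \<delta>: "0 < \<delta>"
    and tail0: "\<forall>E. E \<in> sets lebesgue \<and> E \<subseteq> {0..1} \<and> measure lebesgue E < \<delta> \<longrightarrow>
        (\<forall>f. dominated i 1 f \<longrightarrow> integral\<^sup>L (lebesgue_on E) (\<lambda>t. \<bar>support_fun f (\<Gamma> t)\<bar>) < e / 2)"
    by (elim exE conjE) (rule that)
  have tail: "integral\<^sup>L (lebesgue_on D) (\<lambda>t. \<bar>support_fun f (\<Gamma> t)\<bar>) < e / 2"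
    if "D \<in> sets lebesgue" "D \<subseteq> {0..1}" "measure lebesgue D < \<delta>" "dominated i 1 f" for D f
    using tail0[THEN spec[of _ D]] that by simp
  obtain m :: nat and A c where A: "\<And>j. j < m \<Longrightarrow> A j \<in> sets lebesgue" "\<And>j. j < m \<Longrightarrow> A j \<subseteq> {0..1}"
      "\<And>j k. j < m \<Longrightarrow> k < m \<Longrightarrow> j \<noteq> k \<Longrightarrow> A j \<inter> A k = {}" and c: "\<And>j. j < m \<Longrightarrow> c j \<in> {0..1}"
      and small: "measure lebesgue ({0..1} - (\<Union>j<m. A j)) < \<delta>"
      and near: "\<And>j t. j < m \<Longrightarrow> t \<in> A j \<Longrightarrow> near i (e / 2) (\<Gamma> t) (\<Gamma> (c j))"
    by (rule bochner_measurable_partition[OF \<Gamma> bm e2 \<delta>, of i]) (rule that)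
  define D where "D = {0..1} - (\<Union>j<m. A j)"
  have D: "D \<in> sets lebesgue" "D \<subseteq> {0..1}" unfolding D_def
    using A(1) by (auto intro!: sets.Diff sets.finite_UN)
  have pc: "precompact_convex (\<Gamma> t)" if "t \<in> {0..1}" for t
    using \<Gamma> that by (intro ck_precompact_convex) auto
  have AE: "A j \<inter> E \<in> sets ?M" if "j < m" for j
    using A(1)[OF that] E by (intro sets_lebesgue_on_unit) auto
  define w where "w j = measure ?M (A j \<inter> E)" for j
  obtain I where I: "precompact_convex I"
      "\<And>i' c' f. dominated i' c' f \<Longrightarrow> support_fun f I = (\<Sum>j<m. w j * support_fun f (\<Gamma> (c j)))"
    using precompact_convex_weighted_sum[of m "\<lambda>j. \<Gamma> (c j)" w] pc c by (auto simp: w_def)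
  have "\<bar>support_fun f I - integral\<^sup>L (lebesgue_on E) (\<lambda>t. support_fun f (\<Gamma> t))\<bar> < e"
    if f: "dominated i 1 f" for f
  proof -
    define g where "g t = support_fun f (\<Gamma> t)" for t
    define s where "s t = (\<Sum>j<m. indicator (A j \<inter> E) t * support_fun f (\<Gamma> (c j)))" for t
    have gint: "integrable ?M g" unfolding g_def by (rule int[OF dominated_dual[OF _ f]]) simp
    have indint: "integrable ?M (\<lambda>t. indicator X t * h t)" if "X \<in> sets lebesgue" "X \<subseteq> {0..1}" "integrable ?M h" for X and h :: "real \<Rightarrow> real"
      using integrable_mult_indicator[OF sets_lebesgue_on_unit[OF that(1,2)] that(3)] by simp
    have sint': "integrable ?M (\<lambda>t. indicator (A j \<inter> E) t * v)" if "j < m" for j and v :: real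
      using AE[OF that] by (intro integrable_mult_left integrable_real_indicator) (auto simp: less_top[symmetric])
    have sint: "integrable ?M s" unfolding s_def[abs_def]
      by (intro Bochner_Integration.integrable_sum sint') auto
    have "integral\<^sup>L ?M s = (\<Sum>j<m. \<integral>t. indicator (A j \<inter> E) t * support_fun f (\<Gamma> (c j)) \<partial>?M)"
      unfolding s_def[abs_def] by (intro Bochner_Integration.integral_sum sint') auto
    also have "\<dots> = (\<Sum>j<m. w j * support_fun f (\<Gamma> (c j)))"
    proof (intro sum.cong refl)
      fix j assume "j \<in> {..<m}"
      hence "A j \<inter> E \<inter> space ?M = A j \<inter> E" using sets.sets_into_space[OF AE[of j]] by blast
      thus "(\<integral>t. indicator (A j \<inter> E) t * support_fun f (\<Gamma> (c j)) \<partial>?M) = w j * support_fun f (\<Gamma> (c j))"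
        by (simp only: integral_mult_left_zero Bochner_Integration.integral_indicator w_def)
    qed
    finally have s_I: "integral\<^sup>L ?M s = support_fun f I" using I(2)[OF f] by simp
    have g_E: "integral\<^sup>L (lebesgue_on E) g = (\<integral>t. indicator E t * g t \<partial>?M)"
      by (rule integral_lebesgue_on_subset[OF E]) simp
    have g_D: "integral\<^sup>L (lebesgue_on D) (\<lambda>t. \<bar>g t\<bar>) = (\<integral>t. indicator D t * \<bar>g t\<bar> \<partial>?M)"
      by (rule integral_lebesgue_on_subset[OF D]) simp
    have "integral\<^sup>L (lebesgue_on D) (\<lambda>t. \<bar>g t\<bar>) < e / 2"
      unfolding g_def by (rule tail[OF D _ f]) (use small in \<open>simp add: D_def\<close>)
    hence D_small: "(\<integral>t. indicator D t * \<bar>g t\<bar> \<partial>?M) < e / 2" unfolding g_D .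
    \<comment> \<open>Off the pieces \<open>s\<close> vanishes and the error is the integrand
      itself; on a piece it is the oscillation. Integrating gives e/2 twice, as the interval has
      measure 1.\<close>
    have bound: "\<bar>s t - indicator E t * g t\<bar> \<le> e / 2 + indicator D t * \<bar>g t\<bar>" if t: "t \<in> {0..1}" for t
    proof (cases "t \<in> D")
      case True
      hence "t \<notin> A j" if "j < m" for j using that by (auto simp: D_def)
      hence "s t = 0" unfolding s_def by (intro sum.neutral) auto
      thus ?thesis using True e by (auto simp: indicator_def)
    next
      case False
      then obtain j where j: "j < m" "t \<in> A j" using t by (auto simp: D_def)
      have "indicator (A k \<inter> E) t * support_fun f (\<Gamma> (c k)) =
          (if k = j then indicator E t * support_fun f (\<Gamma> (c j)) else 0)" if "k < m" for k
      proof (cases "k = j")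
        case True thus ?thesis using j by (simp add: indicator_def)
      next
        case False
        hence "t \<notin> A k" using A(3)[OF that j(1)] j(2) by blast
        thus ?thesis using False by simp
      qed
      hence "s t = (\<Sum>k<m. if k = j then indicator E t * support_fun f (\<Gamma> (c j)) else 0)"
        unfolding s_def by (intro sum.cong) auto
      hence st: "s t = indicator E t * support_fun f (\<Gamma> (c j))" using j(1) by simp
      have "\<bar>g t - support_fun f (\<Gamma> (c j))\<bar> \<le> 1 * (e / 2)"
        unfolding g_def using pc[OF t] pc[OF c[OF j(1)]]
        by (intro support_near[OF f _ _ _ _ _ near[OF j]]) (auto simp: precompact_convex_def)
      thus ?thesis using False e by (auto simp: st indicator_def abs_minus_commute)
    qed
    have dint: "integrable ?M (\<lambda>t. s t - indicator E t * g t)"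
      by (intro Bochner_Integration.integrable_diff sint indint E gint)
    have rint: "integrable ?M (\<lambda>t. e / 2 + indicator D t * \<bar>g t\<bar>)"
      by (intro Bochner_Integration.integrable_add indint D integrable_abs gint) simp
    have "\<bar>support_fun f I - integral\<^sup>L (lebesgue_on E) g\<bar> = \<bar>\<integral>t. s t - indicator E t * g t \<partial>?M\<bar>"
      unfolding s_I[symmetric] g_E
      by (subst Bochner_Integration.integral_diff[OF sint indint[OF E gint]]) simp
    also have "\<dots> \<le> (\<integral>t. \<bar>s t - indicator E t * g t\<bar> \<partial>?M)" by (rule integral_abs_bound)
    also have "\<dots> \<le> (\<integral>t. e / 2 + indicator D t * \<bar>g t\<bar> \<partial>?M)"
      by (rule integral_mono[OF integrable_abs[OF dint] rint]) (use bound in auto)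
    also have "\<dots> = (\<integral>t. e / 2 \<partial>?M) + (\<integral>t. indicator D t * \<bar>g t\<bar> \<partial>?M)"
      by (rule Bochner_Integration.integral_add[OF _ indint[OF D integrable_abs[OF gint]]]) simp
    also have "(\<integral>t. e / 2 \<partial>?M) = e / 2" using measure_unit by simp
    finally show ?thesis using D_small unfolding g_def[abs_def] by simp
  qed
  with I(1) show ?thesis by blast
qed

lemma uniformly_integrable_imp_pettis:
  assumes \<Gamma>: "\<forall>t\<in>{0..1}. \<Gamma> t \<in> ck p" and bm: "bochner_measurable_mf p \<Gamma>"
    and ui: "\<And>K. equicontinuous_dual p K \<Longrightarrow> uniformly_integrable_01 ((\<lambda>f t. support_fun f (\<Gamma> t)) ` K)"
  shows "pettis_integrable_ck p \<Gamma>"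
proof -
  have int: "integrable (lebesgue_on {0..1}) (\<lambda>t. support_fun f (\<Gamma> t))" if f: "f \<in> dual_space p" for f
  proof -
    obtain i c where "0 < c" "dominated i c f" using dual_imp_dominated[OF f] by blast
    thus ?thesis
      using ui[OF equicontinuous_dominated, of c i] by (auto simp: uniformly_integrable_01_def)
  qed
  have tail: "\<exists>\<delta>>0. \<forall>E. E \<in> sets lebesgue \<and> E \<subseteq> {0..1} \<and> measure lebesgue E < \<delta> \<longrightarrow>
        (\<forall>f. dominated i 1 f \<longrightarrow> integral\<^sup>L (lebesgue_on E) (\<lambda>t. \<bar>support_fun f (\<Gamma> t)\<bar>) < e)"
    if "0 < e" for i e
  proof -
    have "uniformly_integrable_01 ((\<lambda>f t. support_fun f (\<Gamma> t)) ` {f. dominated i 1 f})"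
      by (intro ui equicontinuous_dominated) simp
    thus ?thesis using that unfolding uniformly_integrable_01_def by simp
  qed
  have "\<exists>xE\<in>ck p. \<forall>f\<in>dual_space p. support_fun f xE = integral\<^sup>L (lebesgue_on E) (\<lambda>t. support_fun f (\<Gamma> t))"
    if E: "E \<in> sets lebesgue" "E \<subseteq> {0..1}" for E
  proof -
    define J where "J f = integral\<^sup>L (lebesgue_on E) (\<lambda>t. support_fun f (\<Gamma> t))" for f
    have pos: "0 < (1/2::real) ^ n" for n by (rule zero_less_power) simp
    \<comment> \<open>The quarter leaves room for comparing consecutive approximants on the polar of
      \<open>p n\<close>, where both error bounds apply because the polars increase with
      \<open>n\<close>.\<close>
    have "\<exists>I. precompact_convex I \<and> (\<forall>f. dominated n 1 f \<longrightarrow> \<bar>support_fun f I - J f\<bar> < (1/2) ^ n / 4)" for n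
      unfolding J_def using pos[of n] by (intro approximating_integral[OF \<Gamma> bm int tail E]) auto
    then obtain I where I: "\<And>n. precompact_convex (I n)"
        "\<And>n f. dominated n 1 f \<Longrightarrow> \<bar>support_fun f (I n) - J f\<bar> < (1/2) ^ n / 4" by metis
    have "near n ((1/2) ^ n) (I n) (I (Suc n))" for n
    proof (rule near_of_support)
      fix f assume f: "dominated n 1 f"
      have "dominated (Suc n) 1 f" by (rule dominated_mono[OF f]) auto
      hence "\<bar>support_fun f (I (Suc n)) - J f\<bar> < (1/2) ^ Suc n / 4" by (rule I(2))
      moreover have "(1/2::real) ^ Suc n / 4 \<le> (1/2) ^ n / 4" by simp
      ultimately have "\<bar>support_fun f (I (Suc n)) - J f\<bar> < (1/2) ^ n / 4" by linarith
      thus "\<bar>support_fun f (I n) - support_fun f (I (Suc n))\<bar> < (1/2) ^ n"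
        using I(2)[OF f] pos[of n] by linarith
    qed (use I(1) in \<open>auto simp: precompact_convex_def\<close>)
    then obtain X where X: "X \<in> ck p" "\<And>n. near n (4 * (1/2) ^ n) X (I n)"
      using ck_limit[of I] I(1) by blast
    have "support_fun f X = J f" if fd: "f \<in> dual_space p" for f
    proof -
      obtain i c where c: "0 < c" "dominated i c f" using dual_imp_dominated[OF fd] by blast
      \<comment> \<open>Rescaling moves \<open>f\<close> into the polar of \<open>p i\<close>; both
        support function and integral scale by the same factor.\<close>
      define g where "g x = f x / c" for x
      have g: "dominated i 1 g" unfolding g_def by (rule dominated_divide[OF c(2,1)])
      have sd: "support_fun g S = support_fun f S / c" if "precompact_convex S" for S
        unfolding g_def using that by (intro support_divide[OF c(2) _ _ c(1)]) (auto simp: precompact_convex_def)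
      have "J g = integral\<^sup>L (lebesgue_on E) (\<lambda>t. support_fun f (\<Gamma> t) / c)"
        unfolding J_def
      proof (intro Bochner_Integration.integral_cong refl sd ck_precompact_convex)
        fix t assume "t \<in> space (lebesgue_on E)"
        thus "\<Gamma> t \<in> ck p" using E(2) \<Gamma> by auto
      qed
      hence Jg: "J g = J f / c" by (simp add: J_def)
      \<comment> \<open>Here 4 comes from the distance of \<open>X\<close> to \<open>I n\<close>,
        and 1 generously covers the quarter from \<open>I n\<close> to the integral.\<close>
      have "\<bar>support_fun g X - J g\<bar> \<le> 5 * (1/2) ^ n" if n: "i \<le> n" for n
      proof -
        have gn: "dominated n 1 g" by (rule dominated_mono[OF g n]) auto
        have "\<bar>support_fun g X - support_fun g (I n)\<bar> \<le> 1 * (4 * (1/2) ^ n)"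
          using ck_precompact_convex[OF X(1)] I(1)[of n]
          by (intro support_near[OF gn _ _ _ _ _ X(2)]) (auto simp: precompact_convex_def)
        thus ?thesis using I(2)[OF gn] pos[of n] by linarith
      qed
      moreover have lim: "(\<lambda>n. 5 * (1/2::real) ^ n) \<longlonglongrightarrow> 5 * 0"
        by (intro tendsto_mult tendsto_const LIMSEQ_power_zero) simp
      ultimately have "\<bar>support_fun g X - J g\<bar> \<le> 5 * 0"
        by (intro LIMSEQ_le_const[OF lim]) blast
      hence "support_fun g X = J g" by simp
      thus ?thesis using sd[OF ck_precompact_convex[OF X(1)]] Jg c(1) by simp
    qed
    thus ?thesis using X(1) by (auto simp: J_def)
  qed
  with int show ?thesis unfolding pettis_integrable_ck_def by blast
qed

section \<open>Convergence of sequences of equicontinuous functionals and of their support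
  functions\<close>

lemma Cauchy_dominated_closure:
  assumes F: "\<And>n. dominated i c (F n)" and c: "0 \<le> c"
    and Y: "\<And>y. y \<in> Y \<Longrightarrow> Cauchy (\<lambda>n. F n y)" and x: "\<And>e. 0 < e \<Longrightarrow> \<exists>y\<in>Y. p i (x - y) < e"
  shows "Cauchy (\<lambda>n. F n x)"
  unfolding Cauchy_iff
proof (intro allI impI)
  fix e :: real assume e: "0 < e"
  hence "0 < e / (4 * (c + 1))" using c by simp
  then obtain y where y: "y \<in> Y" "p i (x - y) < e / (4 * (c + 1))" using x by blast
  have "c * p i (x - y) \<le> c * (e / (4 * (c + 1)))" using y(2) c by (intro mult_left_mono) auto
  also have "\<dots> \<le> e / 4" using c e by (simp add: field_simps)
  finally have cy: "c * p i (x - y) \<le> e / 4" .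
  have e2: "0 < e / 2" using e by simp
  obtain N where N: "\<And>m n. m \<ge> N \<Longrightarrow> n \<ge> N \<Longrightarrow> norm (F m y - F n y) < e / 2"
    using Y[OF y(1)] e2 unfolding Cauchy_iff by blast
  have "norm (F m x - F n x) < e" if "m \<ge> N" "n \<ge> N" for m n
    using dominated_diff[OF F[of m], of x y] dominated_diff[OF F[of n], of x y] N[OF that] cy
    unfolding real_norm_def by linarith
  thus "\<exists>N. \<forall>m\<ge>N. \<forall>n\<ge>N. norm (F m x - F n x) < e" by blast
qed

text \<open>Equicontinuity and a finite net of \<open>S\<close> upgrade pointwise convergence on
  \<open>S\<close> to uniform convergence, and suprema follow uniform limits.\<close>

lemma Cauchy_support_fun:
  assumes F: "\<And>n. dominated i c (F n)" and c: "0 \<le> c" and S: "S \<noteq> {}" "tot_bdd S"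
    and x: "\<And>x. x \<in> S \<Longrightarrow> Cauchy (\<lambda>n. F n x)"
  shows "Cauchy (\<lambda>n. support_fun (F n) S)"
  unfolding Cauchy_iff
proof (intro allI impI)
  fix e :: real assume e: "0 < e"
  hence e4: "0 < e / (8 * (c + 1))" using c by simp
  obtain N where N: "finite N" "N \<subseteq> S" "\<And>x. x \<in> S \<Longrightarrow> \<exists>y\<in>N. p i (x - y) < e / (8 * (c + 1))"
    using tot_bddD[OF S(2) e4, of i] by metis
  have e2: "0 < e / 4" using e by simp
  have "\<exists>M. \<forall>m\<ge>M. \<forall>n\<ge>M. norm (F m y - F n y) < e / 4" if "y \<in> N" for y
    using x[of y] N(2) that e2 unfolding Cauchy_iff by blast
  then obtain L where L: "\<And>y m n. y \<in> N \<Longrightarrow> m \<ge> L y \<Longrightarrow> n \<ge> L y \<Longrightarrow> norm (F m y - F n y) < e / 4"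
    by metis
  define M where "M = (\<Sum>y\<in>N. L y)"
  have LM: "L y \<le> M" if "y \<in> N" for y unfolding M_def using that N(1) by (intro member_le_sum) auto
  have le: "support_fun (F m) S \<le> support_fun (F n) S + 3 * e / 4" if mn: "m \<ge> M" "n \<ge> M" for m n
  proof (rule support_least[OF S(1)])
    fix x assume xS: "x \<in> S"
    obtain y where y: "y \<in> N" "p i (x - y) < e / (8 * (c + 1))" using N(3)[OF xS] by blast
    have "c * p i (x - y) \<le> c * (e / (8 * (c + 1)))" using y(2) c by (intro mult_left_mono) auto
    also have "\<dots> \<le> e / 8" using c e by (simp add: field_simps)
    finally have cy: "c * p i (x - y) \<le> e / 8" .
    have "norm (F m y - F n y) < e / 4" using L[OF y(1)] LM[OF y(1)] mn by simp
    hence "F m x \<le> F n x + 3 * e / 4"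
      using dominated_diff[OF F[of m], of x y] dominated_diff[OF F[of n], of x y] cy e
      unfolding real_norm_def by linarith
    thus "F m x \<le> support_fun (F n) S + 3 * e / 4"
      using support_upper[OF F S(2) xS, of n] by linarith
  qed
  have "norm (support_fun (F m) S - support_fun (F n) S) < e" if "m \<ge> M" "n \<ge> M" for m n
    using le[OF that] le[OF that(2,1)] e unfolding real_norm_def by linarith
  thus "\<exists>M. \<forall>m\<ge>M. \<forall>n\<ge>M. norm (support_fun (F m) S - support_fun (F n) S) < e" by blast
qed

text \<open>A diagonal selection on \<open>D\<close>, after division by
  \<open>1 + \<bar>c\<bar> * p i y\<close> to make the values uniformly bounded by 1. The points of
  convergence form a subspace, so linearity extends the result to the span.\<close>

lemma dominated_subsequence:
  assumes D: "countable D" and F: "\<And>n. dominated i c (F n)"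
  obtains k :: "nat \<Rightarrow> nat" where "strict_mono k" "\<And>y. y \<in> span D \<Longrightarrow> Cauchy (\<lambda>n. F (k n) y)"
proof -
  have pos: "0 < 1 + \<bar>c\<bar> * p i y" for y by (simp add: add_pos_nonneg)
  have "norm (F n y / (1 + \<bar>c\<bar> * p i y)) \<le> 1" for n y
  proof -
    have "\<bar>F n y\<bar> \<le> c * p i y" by (rule dominated_bound[OF F])
    also have "\<dots> \<le> \<bar>c\<bar> * p i y" by (intro mult_right_mono) auto
    finally show ?thesis using pos[of y] by (simp add: divide_le_eq)
  qed
  then obtain k where k: "strict_mono (k :: nat \<Rightarrow> nat)"
      "\<And>y. y \<in> D \<Longrightarrow> \<exists>l. (\<lambda>n. F (k n) y / (1 + \<bar>c\<bar> * p i y)) \<longlonglongrightarrow> l"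
    using function_convergent_subsequence[OF D, of "\<lambda>n y. F n y / (1 + \<bar>c\<bar> * p i y)" 1] by blast
  have "D \<subseteq> {y. convergent (\<lambda>n. F (k n) y)}"
  proof
    fix y assume "y \<in> D"
    then obtain l where "(\<lambda>n. F (k n) y / (1 + \<bar>c\<bar> * p i y)) \<longlonglongrightarrow> l" using k(2) by blast
    hence "(\<lambda>n. F (k n) y / (1 + \<bar>c\<bar> * p i y) * (1 + \<bar>c\<bar> * p i y)) \<longlonglongrightarrow> l * (1 + \<bar>c\<bar> * p i y)"
      by (intro tendsto_mult tendsto_const)
    hence "(\<lambda>n. F (k n) y) \<longlonglongrightarrow> l * (1 + \<bar>c\<bar> * p i y)" using pos[of y] by simp
    thus "y \<in> {y. convergent (\<lambda>n. F (k n) y)}" by (auto simp: convergent_def)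
  qed
  moreover have "subspace {y. convergent (\<lambda>n. F (k n) y)}"
    unfolding subspace_def
    by (auto simp: linear_0[OF dominated_linear[OF F]] linear_add[OF dominated_linear[OF F]]
        linear_scale[OF dominated_linear[OF F]] convergent_const intro: convergent_add convergent_mult)
  ultimately have "span D \<subseteq> {y. convergent (\<lambda>n. F (k n) y)}" by (rule span_minimal)
  hence "Cauchy (\<lambda>n. F (k n) y)" if "y \<in> span D" for y
    using that by (auto simp: Cauchy_convergent_iff)
  thus ?thesis by (rule that[OF k(1)])
qed

text \<open>A functional vanishing on the essential range of \<open>\<Gamma>\<close> vanishes on every Pettis integral,
  so by separation Pettis integrals do not leave the closed span of the range.\<close>

lemma pettis_integral_in_closed_span:
  assumes \<Gamma>: "\<forall>t\<in>{0..1}. \<Gamma> t \<in> ck p"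
    and Z: "Z \<in> null_sets lebesgue"
    and sep: "\<And>t x e. t \<in> {0..1} - Z \<Longrightarrow> x \<in> \<Gamma> t \<Longrightarrow> 0 < e \<Longrightarrow> \<exists>y\<in>D. p i (x - y) < e"
    and E: "E \<in> sets lebesgue" "E \<subseteq> {0..1}" and X: "X \<in> ck p"
    and eq: "\<And>f. f \<in> dual_space p \<Longrightarrow> support_fun f X = integral\<^sup>L (lebesgue_on E) (\<lambda>t. support_fun f (\<Gamma> t))"
    and b: "b \<in> X" and e: "0 < e"
  shows "\<exists>y\<in>span D. p i (b - y) < e"
proof (rule ccontr)
  assume "\<not> ?thesis"
  hence far: "\<And>y. y \<in> span D \<Longrightarrow> e \<le> p i (b - y)" by (auto simp: not_less)
  have "convex (span D)" by (rule subspace_imp_convex[OF subspace_span])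
  moreover have "span D \<noteq> {}" using span_zero by blast
  ultimately obtain f where f: "linear f" "\<And>x. \<bar>f x\<bar> \<le> p i x" "\<And>y. y \<in> span D \<Longrightarrow> f y + e \<le> f b"
    using seminorm_separation[OF seminorm _ _ far] by blast
  have dom: "dominated i 1 f" using f(1,2) by (simp add: dominated_def)
  \<comment> \<open>A functional bounded above on a subspace vanishes on it: the multiple of
    \<open>y\<close> used here would have value \<open>f b\<close>, contradicting the gap.\<close>
  have f0: "f y = 0" if y: "y \<in> span D" for y
  proof (rule ccontr)
    assume ny: "f y \<noteq> 0"
    have "(f b / f y) *\<^sub>R y \<in> span D" using y by (rule span_scale)
    from f(3)[OF this] have "f b + e \<le> f b" using ny by (simp add: linear_scale[OF f(1)])
    thus False using e by simp
  qed
  have fb: "e \<le> f b" using f(3)[OF span_zero] linear_0[OF f(1)] by simp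
  have sup0: "support_fun f (\<Gamma> t) = 0" if t: "t \<in> {0..1} - Z" for t
  proof -
    have "f x = 0" if x: "x \<in> \<Gamma> t" for x
    proof -
      have "\<bar>f x\<bar> \<le> 0 + \<eta>" if \<eta>: "0 < \<eta>" for \<eta>
      proof -
        obtain y where y: "y \<in> D" "p i (x - y) < \<eta>" using sep[OF t x \<eta>] by blast
        have "\<bar>f x - f y\<bar> \<le> 1 * p i (x - y)" by (rule dominated_diff[OF dom])
        thus ?thesis using y f0[OF span_base[OF y(1)]] by simp
      qed
      hence "\<bar>f x\<bar> \<le> 0" by (rule field_le_epsilon)
      thus ?thesis by simp
    qed
    moreover have "\<Gamma> t \<noteq> {}" using \<Gamma> t by (auto simp: ck_def)
    ultimately show ?thesis unfolding support_fun_def by (simp cong: SUP_cong_simp)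
  qed
  have "AE t in lebesgue. t \<notin> Z" using Z by (rule AE_not_in)
  hence "AE t in lebesgue_on E. support_fun f (\<Gamma> t) = 0"
    using E sup0 by (subst AE_restrict_space_iff) (auto elim!: eventually_mono)
  hence "integral\<^sup>L (lebesgue_on E) (\<lambda>t. support_fun f (\<Gamma> t)) = 0"
    by (rule integral_eq_zero_AE)
  hence "support_fun f X = 0" using eq[OF dominated_dual[OF _ dom]] by simp
  thus False using support_upper[OF dom ck_tot_bdd[OF X] b] fb e by simp
qed

text \<open>Pettis integrability turns the integral over \<open>E\<close> into the support function
  of one compact set, so convergence of integrals reduces to pointwise convergence of functionals on
  that set.\<close>

lemma pettis_L1_Cauchy_subsequence:
  assumes \<Gamma>: "\<forall>t\<in>{0..1}. \<Gamma> t \<in> ck p" and bm: "bochner_measurable_mf p \<Gamma>"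
    and pet: "pettis_integrable_ck p \<Gamma>" and F: "\<And>n. dominated i c (F n)" and c: "0 < c"
  obtains k :: "nat \<Rightarrow> nat" where "strict_mono k"
    "\<And>e. 0 < e \<Longrightarrow> \<exists>N. \<forall>m\<ge>N. \<forall>n\<ge>N.
      (\<integral>t. \<bar>support_fun (F (k m)) (\<Gamma> t) - support_fun (F (k n)) (\<Gamma> t)\<bar> \<partial>lebesgue_on {0..1}) < e"
proof -
  let ?M = "lebesgue_on {0..1::real}"
  interpret M: finite_measure ?M by (rule finite_measure_unit)
  obtain D Z where D: "countable D" and Z: "Z \<in> null_sets lebesgue"
    and sep: "\<And>t x e. t \<in> {0..1} - Z \<Longrightarrow> x \<in> \<Gamma> t \<Longrightarrow> 0 < e \<Longrightarrow> \<exists>y\<in>D. p i (x - y) < e"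
    by (rule bochner_measurable_essentially_separable[OF \<Gamma> bm, of i]) (rule that)
  obtain k :: "nat \<Rightarrow> nat" where k: "strict_mono k" and kD: "\<And>y. y \<in> span D \<Longrightarrow> Cauchy (\<lambda>n. F (k n) y)"
    by (rule dominated_subsequence[OF D F]) (rule that)
  have Fd: "F n \<in> dual_space p" for n by (rule dominated_dual[OF c F])
  \<comment> \<open>Used twice: for the values \<Gamma> t it gives almost everywhere convergence,
    for the Pettis integrals it gives convergence over each measurable set.\<close>
  have cauchy: "Cauchy (\<lambda>n. support_fun (F (k n)) S)"
    if S: "S \<in> ck p" and cl: "\<And>x e. x \<in> S \<Longrightarrow> 0 < e \<Longrightarrow> \<exists>y\<in>span D. p i (x - y) < e" for S
  proof (rule Cauchy_support_fun)
    show "dominated i c (F (k n))" for n by (rule F)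
    show "0 \<le> c" using c by simp
    show "S \<noteq> {}" "tot_bdd S" using S ck_tot_bdd by (auto simp: ck_def)
    fix x assume x: "x \<in> S"
    show "Cauchy (\<lambda>n. F (k n) x)"
      by (rule Cauchy_dominated_closure[of i c _ "span D"]) (use F c kD cl[OF x] in auto)
  qed
  have "\<exists>N. \<forall>m\<ge>N. \<forall>n\<ge>N.
      (\<integral>t. \<bar>support_fun (F (k m)) (\<Gamma> t) - support_fun (F (k n)) (\<Gamma> t)\<bar> \<partial>?M) < e" if e: "0 < e" for e
  proof (rule M.setwise_Cauchy_imp_L1_Cauchy[OF _ _ _ e])
    show "integrable ?M (\<lambda>t. support_fun (F (k n)) (\<Gamma> t))" for n
      using pet Fd unfolding pettis_integrable_ck_def by blast
    have "AE t in lebesgue. t \<notin> Z" using Z by (rule AE_not_in)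
    moreover have "Cauchy (\<lambda>n. support_fun (F (k n)) (\<Gamma> t))" if t: "t \<in> {0..1} - Z" for t
    proof (rule cauchy)
      show "\<Gamma> t \<in> ck p" using \<Gamma> t by blast
      show "\<exists>y\<in>span D. p i (x - y) < e" if "x \<in> \<Gamma> t" "0 < e" for x e
        using sep[OF t that] span_base by blast
    qed
    ultimately show "AE t in ?M. Cauchy (\<lambda>n. support_fun (F (k n)) (\<Gamma> t))"
      by (subst AE_restrict_space_iff) (auto elim!: eventually_mono)
    fix E assume "E \<in> sets ?M"
    hence E: "E \<in> sets lebesgue" "E \<subseteq> {0..1}" by (auto simp: sets_restrict_space_iff)
    hence "\<exists>X\<in>ck p. \<forall>f\<in>dual_space p. support_fun f X = integral\<^sup>L (lebesgue_on E) (\<lambda>t. support_fun f (\<Gamma> t))"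
      using pet unfolding pettis_integrable_ck_def by simp
    then obtain X where X: "X \<in> ck p"
        and eq: "\<And>f. f \<in> dual_space p \<Longrightarrow> support_fun f X = integral\<^sup>L (lebesgue_on E) (\<lambda>t. support_fun f (\<Gamma> t))"
      by blast
    have "Cauchy (\<lambda>n. support_fun (F (k n)) X)"
      by (rule cauchy[OF X]) (rule pettis_integral_in_closed_span[OF \<Gamma> Z sep E X eq])
    moreover have "support_fun (F (k n)) X = (\<integral>t. indicator E t * support_fun (F (k n)) (\<Gamma> t) \<partial>?M)" for n
      unfolding eq[OF Fd] by (rule integral_lebesgue_on_subset[OF E]) simp
    ultimately show "Cauchy (\<lambda>n. \<integral>t. indicator E t * support_fun (F (k n)) (\<Gamma> t) \<partial>?M)" by simp
  qed
  thus ?thesis by (rule that[OF k])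
qed

text \<open>Both bounds go by contradiction. A sequence of violators has an L1-Cauchy subsequence,
  whose late members differ little from the single integrable function
  \<open>support_fun (F (k N)) (\<Gamma> t)\<close>, for which the bound holds.\<close>

lemma pettis_imp_uniformly_integrable:
  assumes \<Gamma>: "\<forall>t\<in>{0..1}. \<Gamma> t \<in> ck p" and bm: "bochner_measurable_mf p \<Gamma>"
    and pet: "pettis_integrable_ck p \<Gamma>" and K: "equicontinuous_dual p K"
  shows "uniformly_integrable_01 ((\<lambda>f t. support_fun f (\<Gamma> t)) ` K)"
proof -
  let ?M = "lebesgue_on {0..1::real}"
  let ?g = "\<lambda>f t. support_fun f (\<Gamma> t)"
  interpret M: finite_measure ?M by (rule finite_measure_unit)
  obtain i c where c: "0 < c" and dom: "\<And>f. f \<in> K \<Longrightarrow> dominated i c f"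
    by (rule equicontinuous_imp_dominated[OF K]) (rule that)
  have int: "integrable ?M (?g f)" if "f \<in> K" for f
    using pet K that unfolding pettis_integrable_ck_def equicontinuous_dual_def by blast
  have indint: "integrable ?M (\<lambda>t. indicator E t * h t)" if "E \<in> sets ?M" "integrable ?M h" for E and h :: "real \<Rightarrow> real"
    using integrable_mult_indicator[OF that] by simp
  \<comment> \<open>With \<open>E\<close> the whole interval this serves the norm bound, with small
    \<open>E\<close> the equi-absolute continuity.\<close>
  have split: "(\<integral>t. indicator E t * \<bar>?g f t\<bar> \<partial>?M) \<le> (\<integral>t. \<bar>?g f t - ?g f' t\<bar> \<partial>?M) + (\<integral>t. indicator E t * \<bar>?g f' t\<bar> \<partial>?M)"
    if f: "f \<in> K" "f' \<in> K" and E: "E \<in> sets ?M" for f f' E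
  proof -
    note d = integrable_abs[OF Bochner_Integration.integrable_diff[OF int[OF f(1)] int[OF f(2)]]]
    note a = indint[OF E integrable_abs[OF int[OF f(1)]]]
    note b = indint[OF E integrable_abs[OF int[OF f(2)]]]
    have "(\<integral>t. indicator E t * \<bar>?g f t\<bar> \<partial>?M) \<le> (\<integral>t. \<bar>?g f t - ?g f' t\<bar> + indicator E t * \<bar>?g f' t\<bar> \<partial>?M)"
      by (rule integral_mono[OF a Bochner_Integration.integrable_add[OF d b]]) (auto simp: indicator_def)
    also have "\<dots> = (\<integral>t. \<bar>?g f t - ?g f' t\<bar> \<partial>?M) + (\<integral>t. indicator E t * \<bar>?g f' t\<bar> \<partial>?M)"
      by (rule Bochner_Integration.integral_add[OF d b])
    finally show ?thesis .
  qed
  have one: "(\<integral>t. indicator {0..1} t * h t \<partial>?M) = integral\<^sup>L ?M h" for h :: "real \<Rightarrow> real"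
    by (intro Bochner_Integration.integral_cong) auto
  have "\<exists>B. \<forall>f\<in>K. integral\<^sup>L ?M (\<lambda>t. \<bar>?g f t\<bar>) \<le> B"
  proof (rule ccontr)
    assume "\<not> ?thesis"
    hence "\<forall>n. \<exists>f. f \<in> K \<and> real n < integral\<^sup>L ?M (\<lambda>t. \<bar>?g f t\<bar>)" by (auto simp: not_le)
    then obtain F where F: "\<And>n. F n \<in> K" "\<And>n. real n < integral\<^sup>L ?M (\<lambda>t. \<bar>?g (F n) t\<bar>)" by metis
    obtain k :: "nat \<Rightarrow> nat" where k: "strict_mono k" and ca: "\<And>e. 0 < e \<Longrightarrow> \<exists>N. \<forall>m\<ge>N. \<forall>n\<ge>N.
      (\<integral>t. \<bar>?g (F (k m)) t - ?g (F (k n)) t\<bar> \<partial>?M) < e"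
      by (rule pettis_L1_Cauchy_subsequence[OF \<Gamma> bm pet dom[OF F(1)] c]) (rule that)
    obtain N where N: "\<And>m. m \<ge> N \<Longrightarrow> (\<integral>t. \<bar>?g (F (k m)) t - ?g (F (k N)) t\<bar> \<partial>?M) < 1"
      using ca[OF zero_less_one] by blast
    define B where "B = integral\<^sup>L ?M (\<lambda>t. \<bar>?g (F (k N)) t\<bar>)"
    obtain n where n: "1 + B < real n" using reals_Archimedean2 by blast
    \<comment> \<open>\<open>m \<ge> N\<close> gives closeness to the reference function, while
      \<open>k m \<ge> m \<ge> n\<close> makes the assumed norm too large.\<close>
    define m where "m = max N n"
    have "integral\<^sup>L ?M (\<lambda>t. \<bar>?g (F (k m)) t\<bar>) \<le> (\<integral>t. \<bar>?g (F (k m)) t - ?g (F (k N)) t\<bar> \<partial>?M) + B"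
      using split[OF F(1) F(1), of "{0..1}" "k m" "k N"] by (simp add: one B_def sets_restrict_space_iff)
    moreover have "(\<integral>t. \<bar>?g (F (k m)) t - ?g (F (k N)) t\<bar> \<partial>?M) < 1" by (rule N) (simp add: m_def)
    moreover have "real (k m) < integral\<^sup>L ?M (\<lambda>t. \<bar>?g (F (k m)) t\<bar>)" by (rule F(2))
    moreover have "real n \<le> real (k m)" using seq_suble[OF k, of m] by (simp add: m_def)
    ultimately show False using n by linarith
  qed
  moreover have "\<exists>\<delta>>0. \<forall>E. E \<in> sets lebesgue \<and> E \<subseteq> {0..1} \<and> measure lebesgue E < \<delta> \<longrightarrow>
      (\<forall>f\<in>K. integral\<^sup>L (lebesgue_on E) (\<lambda>t. \<bar>?g f t\<bar>) < e)" if e: "0 < e" for e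
  proof (rule ccontr)
    assume contra: "\<not> ?thesis"
    have "\<exists>E f. E \<in> sets lebesgue \<and> E \<subseteq> {0..1} \<and> measure lebesgue E < inverse (real (Suc n)) \<and>
        f \<in> K \<and> e \<le> integral\<^sup>L (lebesgue_on E) (\<lambda>t. \<bar>?g f t\<bar>)" for n
    proof -
      have "0 < inverse (real (Suc n))" by simp
      with contra show ?thesis by (metis not_less)
    qed
    then obtain E F where E: "\<And>n. E n \<in> sets lebesgue" "\<And>n. E n \<subseteq> {0..1}"
        "\<And>n. measure lebesgue (E n) < inverse (real (Suc n))"
      and F: "\<And>n. F n \<in> K" "\<And>n. e \<le> integral\<^sup>L (lebesgue_on (E n)) (\<lambda>t. \<bar>?g (F n) t\<bar>)" by metis
    obtain k :: "nat \<Rightarrow> nat" where k: "strict_mono k" and ca: "\<And>e. 0 < e \<Longrightarrow> \<exists>N. \<forall>m\<ge>N. \<forall>n\<ge>N.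
      (\<integral>t. \<bar>?g (F (k m)) t - ?g (F (k n)) t\<bar> \<partial>?M) < e"
      by (rule pettis_L1_Cauchy_subsequence[OF \<Gamma> bm pet dom[OF F(1)] c]) (rule that)
    have e2: "0 < e / 2" using e by simp
    obtain N where N: "\<And>m. m \<ge> N \<Longrightarrow> (\<integral>t. \<bar>?g (F (k m)) t - ?g (F (k N)) t\<bar> \<partial>?M) < e / 2"
      using ca[OF e2] by blast
    obtain \<delta> where \<delta>: "0 < \<delta>" "\<And>A. A \<in> sets ?M \<Longrightarrow> measure ?M A < \<delta> \<Longrightarrow>
        (\<integral>t. indicator A t * \<bar>?g (F (k N)) t\<bar> \<partial>?M) < e / 2"
      using M.integral_absolutely_continuous[OF int[OF F(1)] e2] by blast
    obtain n where n: "inverse (real (Suc n)) < \<delta>" using reals_Archimedean[OF \<delta>(1)] by blast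
    define m where "m = max N n"
    have Em: "E (k m) \<in> sets ?M" by (rule sets_lebesgue_on_unit[OF E(1,2)])
    have "measure ?M (E (k m)) = measure lebesgue (E (k m))"
      by (rule measure_lebesgue_on_subset[OF E(1,2)]) simp
    also have "\<dots> < inverse (real (Suc (k m)))" by (rule E(3))
    also have "\<dots> \<le> inverse (real (Suc n))"
      using seq_suble[OF k, of m] by (intro le_imp_inverse_le) (auto simp: m_def)
    finally have "measure ?M (E (k m)) < \<delta>" using n by linarith
    hence "(\<integral>t. indicator (E (k m)) t * \<bar>?g (F (k N)) t\<bar> \<partial>?M) < e / 2" by (rule \<delta>(2)[OF Em])
    moreover have "(\<integral>t. \<bar>?g (F (k m)) t - ?g (F (k N)) t\<bar> \<partial>?M) < e / 2" by (rule N) (simp add: m_def)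
    moreover have "e \<le> (\<integral>t. indicator (E (k m)) t * \<bar>?g (F (k m)) t\<bar> \<partial>?M)"
      using F(2)[of "k m"] integral_lebesgue_on_subset[OF E(1)[of "k m"] E(2)[of "k m"], of "\<lambda>t. \<bar>?g (F (k m)) t\<bar>"] by simp
    ultimately show False using split[OF F(1) F(1) Em, of "k m" "k N"] by linarith
  qed
  ultimately show ?thesis using int unfolding uniformly_integrable_01_def by simp
qed

end

theorem theorem4p4:
  fixes p :: "nat \<Rightarrow> 'a::real_vector \<Rightarrow> real" and \<Gamma> :: "real \<Rightarrow> 'a set"
  assumes "frechet_space p"
    and "\<forall>t\<in>{0..1}. \<Gamma> t \<in> ck p"
    and "bochner_measurable_mf p \<Gamma>"
  shows "pettis_integrable_ck p \<Gamma> \<longleftrightarrow>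
    (\<forall>K. equicontinuous_dual p K \<longrightarrow>
       uniformly_integrable_01 ((\<lambda>f. (\<lambda>t. support_fun f (\<Gamma> t))) ` K))"
proof -
  interpret frechet p by unfold_locales (rule assms(1))
  show ?thesis
    using pettis_imp_uniformly_integrable[OF assms(2,3)] uniformly_integrable_imp_pettis[OF assms(2,3)] by blast
qed

end
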